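(* Let $n\ge 2$. There is a constant $\delta_0=\delta_0(n)>0$ with the following property. Let $F\subset S^{n-1}$ be a good Cantor set, i.e. a compact set such that $S^{n-1}\setminus F=\bigcup_{i\in\mathbb{N}}U_i$ is a disjoint union of open round balls $U_i$ of $S^{n-1}$ (standard metric) whose radii are bounded by $\delta_0$. Then there exist immersions $x:S^n\to\mathbb{R}^{n+1}$ such that $\operatorname{rank}(x)=n-1$, the Gauss–Kronecker curvature $H_n$ of $x$ is non-negative everywhere, and $\{p\in S^n: H_n(p)=0\}=F\times D^1$, where $D^1$ is a $1$-dimensional disk (here $F\times D^1$ is regarded as a subset of a closed band $S^{n-1}\times D^1\subset S^n$ around an equator $S^{n-1}$ of $S^n$).
   Context: For an immersion $x:M^n\to\mathbb{R}^{n+1}$ of an orientable manifold with Gauss map $N:M\to S^n$ (for a fixed orientation), the principal curvatures are the eigenvalues of the self-adjoint map $dN$, the Gauss–Kronecker curvature is $H_n=\det(dN)$, and $\operatorname{rank}(x):=\min_{p\in M}\operatorname{rank}(d_pN)$. *)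

theory Defs
  imports "HOL-Analysis.Analysis"
begin

fun iter_dderiv :: "'a::real_normed_vector list \<Rightarrow> ('a \<Rightarrow> 'b::real_normed_vector) \<Rightarrow> 'a \<Rightarrow> 'b" where
  "iter_dderiv [] f = f"
| "iter_dderiv (v # vs) f = (\<lambda>y. frechet_derivative (iter_dderiv vs f) (at y) v)"

definition smooth_on :: "'a::real_normed_vector set \<Rightarrow> ('a \<Rightarrow> 'b::real_normed_vector) \<Rightarrow> bool" where
  "smooth_on U f \<longleftrightarrow> open U \<and> (\<forall>vs. iter_dderiv vs f differentiable_on U)"

definition equator :: "real^'n \<Rightarrow> (real^'n) set" where
  "equator e = {q. norm q = 1 \<and> q \<bullet> e = 0}"

definition geo_ball :: "(real^'n) set \<Rightarrow> real^'n \<Rightarrow> real \<Rightarrow> (real^'n) set" where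
  "geo_ball S c r = {q \<in> S. arccos (c \<bullet> q) < r}"

definition good_cantor_set :: "real \<Rightarrow> real^'n \<Rightarrow> (real^'n) set \<Rightarrow> bool" where
  "good_cantor_set \<delta> e F \<longleftrightarrow> compact F \<and> F \<subseteq> equator e \<and>
     (\<exists>(c :: nat \<Rightarrow> real^'n) (r :: nat \<Rightarrow> real).
        (\<forall>i. c i \<in> equator e \<and> 0 < r i \<and> r i \<le> \<delta>) \<and>
        (\<forall>i j. i \<noteq> j \<longrightarrow> geo_ball (equator e) (c i) (r i) \<inter> geo_ball (equator e) (c j) (r j) = {}) \<and>
        equator e - F = (\<Union>i. geo_ball (equator e) (c i) (r i)))"

definition tang :: "real^'n \<Rightarrow> (real^'n) set" where
  "tang p = {v. v \<bullet> p = 0}"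

text \<open>N is a (continuous, hence orienting) Gauss map of the immersion x of the unit sphere.\<close>
definition gauss_map :: "(real^'n \<Rightarrow> real^'n) \<Rightarrow> (real^'n \<Rightarrow> real^'n) \<Rightarrow> bool" where
  "gauss_map x N \<longleftrightarrow> continuous_on (sphere 0 1) N \<and>
     (\<forall>p \<in> sphere 0 1. norm (N p) = 1 \<and>
        (\<forall>v \<in> tang p. N p \<bullet> frechet_derivative x (at p) v = 0))"

definition ext_map :: "real^'n \<Rightarrow> (real^'n \<Rightarrow> real^'n) \<Rightarrow> real^'n \<Rightarrow> real^'n \<Rightarrow> real^'n" where
  "ext_map p L w v = L (v - (v \<bullet> p) *\<^sub>R p) + (v \<bullet> p) *\<^sub>R w"

text \<open>Gauss-Kronecker curvature H_n(p) = det(dN_p), where dN_p is regarded as an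
  endomorphism A of T_p S^n via dx_p (dN_p = dx_p o A). Computed as
  det(ext dN_p)/det(ext dx_p), both extended by p |-> N p.\<close>
definition GK_curv :: "(real^'n \<Rightarrow> real^'n) \<Rightarrow> (real^'n \<Rightarrow> real^'n) \<Rightarrow> (real^'n \<Rightarrow> real^'n \<Rightarrow> real^'n) \<Rightarrow> real^'n \<Rightarrow> real" where
  "GK_curv x N N' p = det (matrix (ext_map p (N' p) (N p))) /
                      det (matrix (ext_map p (frechet_derivative x (at p)) (N p)))"

definition shape_rank :: "(real^'n \<Rightarrow> real^'n \<Rightarrow> real^'n) \<Rightarrow> real^'n \<Rightarrow> nat" where
  "shape_rank N' p = dim (N' p ` tang p)"

text \<open>F x D^1 inside the closed band S^(n-1) x [-c,c] around the equator.\<close>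
definition band_set :: "real^'n \<Rightarrow> real \<Rightarrow> (real^'n) set \<Rightarrow> (real^'n) set" where
  "band_set e c F = {p \<in> sphere 0 1. \<bar>p \<bullet> e\<bar> \<le> c \<and>
      (1 / norm (p - (p \<bullet> e) *\<^sub>R e)) *\<^sub>R (p - (p \<bullet> e) *\<^sub>R e) \<in> F}"

end

theory Submission
  imports Defs "HOL-Computational_Algebra.Polynomial"
begin

text \<open>
  Write \<open>z = y + t e\<close> with \<open>y\<close> orthogonal to \<open>e\<close>. Let \<open>f\<close> be a smooth convex function vanishing exactly on
  \<open>[-1, 1]\<close>, with \<open>f'' > 0\<close> elsewhere, so that \<open>|y|^2 / 2 + f t = 1 / 2\<close> is a cylinder with convex caps.
  Since a ball of the equator is the trace of a half space \<open>c_i \<bullet> z > cos r_i\<close>, the function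
  \<open>\<psi> z = (\<Sum>i. 2^(-i) h (c_i \<bullet> z - cos r_i))\<close> with \<open>h s = exp (- 1 / s)\<close> for \<open>s > 0\<close> and \<open>h s = 0\<close> otherwise
  is smooth, nonnegative, and its zero set on the equator is \<open>F\<close>.

  The immersion is the radial parametrisation of the level set at height \<open>1 / 2\<close> of
  \<open>G z = |y|^2 / 2 + f t + \<epsilon> \<psi> z (1 + t^2)\<close>. From \<open>h'^2 \<le> B h\<close> one gets, for small \<open>\<epsilon>\<close> and \<open>v = \<eta> + \<tau> e\<close>,
  that \<open>Hess G (v, v) \<ge> |\<eta>|^2 / 2 + (f'' t + \<epsilon> \<psi> z) \<tau>^2\<close> on this level set. Hence the curvature is nonnegative,
  the second fundamental form has rank at least \<open>n - 1\<close>, and it degenerates exactly where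
  \<open>\<psi> z = 0\<close> and \<open>|t| \<le> 1\<close>, in the direction \<open>e\<close>. There \<open>|y| = 1\<close>, so seen from the origin these points form the
  band \<open>F \<times> D^1\<close> with \<open>|p \<bullet> e| \<le> 1 / sqrt 2\<close>.
\<close>

section \<open>Flat functions\<close>

text \<open>The polynomial in 1 / s makes the family closed under differentiation.
  \<open>flat 1\<close> is the function h of the overview.\<close>

definition flat :: "real poly \<Rightarrow> real \<Rightarrow> real" where
  "flat P s = (if s > 0 then poly P (1 / s) * exp (- (1 / s)) else 0)"

text \<open>With u = 1 / s one has u' = - u^2, so the derivative of P(u) exp (- u) is u^2 (P(u) -
  P'(u)) exp (- u); \<open>[:0, 0, 1:]\<close> is u^2.\<close>

definition flat_deriv :: "real poly \<Rightarrow> real poly" where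
  "flat_deriv P = [:0, 0, 1:] * (P - pderiv P)"

lemma power_le_fact_exp:
  fixes u :: real
  assumes "u \<ge> 0"
  shows "u ^ i \<le> fact i * exp u"
proof -
  have "u ^ i /\<^sub>R fact i \<le> (\<Sum>n. u ^ n /\<^sub>R fact n)"
    using sum_le_suminf[of "\<lambda>n. u ^ n /\<^sub>R fact n" "{i}"] assms summable_exp_generic[of u]
    by simp
  then have "u ^ i / fact i \<le> exp u"
    by (simp add: exp_def field_simps)
  then show ?thesis
    by (simp add: field_simps)
qed

text \<open>Monomial by monomial, u^i exp (- u) <= i!, because u^i / i! is a single term of the
  exponential series.\<close>

lemma flat_bounded: "\<exists>B>0. \<forall>s. \<bar>flat P s\<bar> \<le> B"
proof -
  let ?B = "\<Sum>i\<le>degree P. \<bar>coeff P i\<bar> * fact i"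
  \<comment> \<open>The extra 1 keeps the bound positive even for P = 0.\<close>
  have "\<bar>flat P s\<bar> \<le> ?B + 1" for s
  proof (cases "s > 0")
    case True
    define u where "u = 1 / s"
    have u: "u \<ge> 0" using True by (simp add: u_def)
    have "\<bar>poly P u\<bar> \<le> (\<Sum>i\<le>degree P. \<bar>coeff P i\<bar> * u ^ i)"
      unfolding poly_altdef using u
      by (intro order_trans[OF sum_abs] sum_mono) (simp add: abs_mult)
    also have "\<dots> \<le> (\<Sum>i\<le>degree P. \<bar>coeff P i\<bar> * (fact i * exp u))"
      by (intro sum_mono mult_left_mono power_le_fact_exp u) auto
    also have "\<dots> = ?B * exp u"
      by (simp add: sum_distrib_right mult.assoc)
    finally have "\<bar>poly P u\<bar> * exp (-u) \<le> ?B"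
      by (simp add: exp_minus field_simps)
    then show ?thesis
      using True by (simp add: flat_def u_def[symmetric] abs_mult)
  next
    case False
    then show ?thesis by (simp add: flat_def sum_nonneg add_nonneg_nonneg)
  qed
  moreover have "?B + 1 > 0"
    by (simp add: sum_nonneg add_nonneg_pos)
  ultimately show ?thesis by blast
qed

text \<open>Splitting off s^2 leaves a bounded factor of the same kind. This is the quadratic bound
  that makes the derivative at 0 vanish.\<close>

lemma flat_square: "flat P s = s\<^sup>2 * flat ([:0, 0, 1:] * P) s"
  by (simp add: flat_def power2_eq_square)

lemma has_real_derivative_zero_if_quadratic_bound:
  fixes f :: "real \<Rightarrow> real"
  assumes "\<And>s. \<bar>f s\<bar> \<le> B * s\<^sup>2"
  shows "(f has_real_derivative 0) (at 0)"
proof -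
  have f0: "f 0 = 0" using assms[of 0] by simp
  have "((\<lambda>h. (f (0 + h) - f 0) / h) \<longlongrightarrow> 0) (at 0)"
  proof (rule Lim_null_comparison)
    show "\<forall>\<^sub>F h in at 0. norm ((f (0 + h) - f 0) / h) \<le> B * \<bar>h\<bar>"
    proof (rule eventually_at_filter[THEN iffD2], rule always_eventually, intro allI impI)
      fix h :: real assume "h \<noteq> 0"
      then show "norm ((f (0 + h) - f 0) / h) \<le> B * \<bar>h\<bar>"
        using assms[of h] by (simp add: f0 pos_divide_le_eq power2_eq_square mult.assoc)
    qed
    have "((\<lambda>h::real. B * \<bar>h\<bar>) \<longlongrightarrow> B * \<bar>0\<bar>) (at 0)"
      by (intro tendsto_intros)
    then show "((\<lambda>h::real. B * \<bar>h\<bar>) \<longlongrightarrow> 0) (at 0)" by simp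
  qed
  then show ?thesis by (simp add: DERIV_def)
qed

lemma flat_has_derivative: "(flat P has_real_derivative flat (flat_deriv P) s) (at s)"
proof -
  consider "s > 0" | "s = 0" | "s < 0" by linarith
  then show ?thesis
  proof cases
    case 1
    show ?thesis
    proof (rule has_field_derivative_transform_within_open[where S = "{0<..}"])
      have "((\<lambda>s. 1 / s) has_real_derivative - (1 / s)\<^sup>2) (at s)"
        using 1 by (auto intro!: derivative_eq_intros simp: power2_eq_square)
      note d = this
      show "((\<lambda>s. poly P (1 / s) * exp (- (1 / s))) has_real_derivative flat (flat_deriv P) s) (at s)"
        by (rule DERIV_cong[OF DERIV_mult[OF DERIV_chain2[OF poly_DERIV d]
              DERIV_chain2[OF DERIV_exp DERIV_minus[OF d]]]])
          (use 1 in \<open>simp add: flat_def flat_deriv_def algebra_simps power2_eq_square\<close>)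
    qed (use 1 in \<open>auto simp: flat_def\<close>)
  next
    case 2
    obtain B where "\<And>s. \<bar>flat ([:0, 0, 1:] * P) s\<bar> \<le> B"
      using flat_bounded by blast
    then have "\<bar>flat P s\<bar> \<le> B * s\<^sup>2" for s
      by (subst flat_square) (simp add: abs_mult mult.commute[of _ "s\<^sup>2"] mult_left_mono)
    from has_real_derivative_zero_if_quadratic_bound[OF this] 2 show ?thesis
      by (simp add: flat_def[of _ 0])
  next
    case 3
    show ?thesis
    proof (rule has_field_derivative_transform_within_open[where S = "{..<0}" and f = "\<lambda>s. 0"])
      show "((\<lambda>s. 0) has_real_derivative flat (flat_deriv P) s) (at s)"
        using 3 by (auto simp: flat_def)
    qed (use 3 in \<open>auto simp: flat_def\<close>)
  qed
qed

lemma flat_nonneg: "(\<And>u. u > 0 \<Longrightarrow> 0 \<le> poly P u) \<Longrightarrow> 0 \<le> flat P s"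
  by (simp add: flat_def)

lemma flat_pos: "(\<And>u. u > 0 \<Longrightarrow> 0 < poly P u) \<Longrightarrow> 0 < s \<Longrightarrow> 0 < flat P s"
  by (simp add: flat_def)

lemma flat_nonpos [simp]: "s \<le> 0 \<Longrightarrow> flat P s = 0"
  by (simp add: flat_def)

lemma flat_deriv_1: "flat_deriv 1 = [:0, 0, 1:]"
  by (simp add: flat_deriv_def one_pCons)

text \<open>The first factor on the right is bounded, so this is the source of h'^2 <= B h.\<close>

lemma flat_deriv_1_sq: "(flat [:0, 0, 1:] s)\<^sup>2 = flat [:0, 0, 0, 0, 1:] s * flat 1 s"
  by (simp add: flat_def power2_eq_square)

section \<open>Finite order differentiability\<close>

text \<open>\<open>Ck_on k\<close> means \<open>k\<close> times differentiable on an open set; continuity of the \<open>k\<close>-th derivatives is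
  not required, so \<open>Ck_on 0\<close> is vacuous. Smoothness is \<open>Ck_on k\<close> for all \<open>k\<close>.\<close>
fun Ck_on :: "nat \<Rightarrow> 'a::euclidean_space set \<Rightarrow> ('a \<Rightarrow> 'b::real_normed_vector) \<Rightarrow> bool" where
  "Ck_on 0 U f \<longleftrightarrow> True"
| "Ck_on (Suc k) U f \<longleftrightarrow>
     (\<exists>f'. (\<forall>z\<in>U. (f has_derivative f' z) (at z)) \<and> (\<forall>v. Ck_on k U (\<lambda>z. f' z v)))"

lemma Ck_on_SucI:
  assumes "\<And>z. z \<in> U \<Longrightarrow> (f has_derivative f' z) (at z)" "\<And>v. Ck_on k U (\<lambda>z. f' z v)"
  shows "Ck_on (Suc k) U f"
  using assms by auto

lemma Ck_on_SucD: "Ck_on (Suc k) U f \<Longrightarrow> Ck_on k U f"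
proof (induction k arbitrary: f)
  case (Suc k)
  from Suc.prems obtain f' where
    "\<forall>z\<in>U. (f has_derivative f' z) (at z)" "\<forall>v. Ck_on (Suc k) U (\<lambda>z. f' z v)"
    by (metis Ck_on.simps(2))
  then show ?case using Suc.IH by auto
qed auto

lemma Ck_on_cong:
  assumes "open U" "\<And>z. z \<in> U \<Longrightarrow> f z = g z" "Ck_on k U f"
  shows "Ck_on k U g"
proof (cases k)
  case (Suc j)
  then obtain f' where f': "\<forall>z\<in>U. (f has_derivative f' z) (at z)" "\<forall>v. Ck_on j U (\<lambda>z. f' z v)"
    using assms(3) by auto
  have "(g has_derivative f' z) (at z)" if "z \<in> U" for z
    using has_derivative_transform_within_open[of f "f' z" z UNIV U g] f'(1) assms that by auto
  then show ?thesis using f'(2) Suc by auto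
qed auto

lemma Ck_on_deriv:
  assumes "open U" "Ck_on (Suc k) U f" "\<And>z. z \<in> U \<Longrightarrow> (f has_derivative f' z) (at z)"
  shows "Ck_on k U (\<lambda>z. f' z v)"
proof -
  from assms(2) obtain D where D: "\<forall>z\<in>U. (f has_derivative D z) (at z)" "\<forall>v. Ck_on k U (\<lambda>z. D z v)"
    by auto
  have "D z = f' z" if "z \<in> U" for z
    using has_derivative_unique D(1) assms(3) that by blast
  then show ?thesis
    using Ck_on_cong[OF assms(1), of "\<lambda>z. D z v" "\<lambda>z. f' z v" k] D(2) by auto
qed

text \<open>Each vector in \<open>vs\<close> costs one order of differentiability, so the induction
  has to carry all orders k at once.\<close>

lemma smooth_on_if_Ck_on:
  assumes "open U" "\<And>k. Ck_on k U f"
  shows "smooth_on U f"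
proof -
  have *: "Ck_on k U (iter_dderiv vs f)" for vs k
  proof (induction vs arbitrary: k)
    case (Cons v vs)
    from Cons.IH[of "Suc 0"] have
      "\<forall>z\<in>U. (iter_dderiv vs f has_derivative frechet_derivative (iter_dderiv vs f) (at z)) (at z)"
      by (auto intro: differentiableI dest!: bspec simp: frechet_derivative_works[symmetric])
    then show ?case
      using Ck_on_deriv[OF assms(1) Cons.IH[of "Suc k"],
          of "\<lambda>z. frechet_derivative (iter_dderiv vs f) (at z)"] by simp
  qed (use assms in auto)
  have "iter_dderiv vs f differentiable_on U" for vs
    using *[of "Suc 0" vs]
    by (auto simp: differentiable_on_def intro: differentiableI has_derivative_at_withinI)
  then show ?thesis using assms(1) by (simp add: smooth_on_def)
qed

lemma Ck_on_const: "Ck_on k U (\<lambda>z. a)"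
proof (induction k arbitrary: a)
  case (Suc k)
  show ?case
    by (rule Ck_on_SucI[of _ _ "\<lambda>z v. 0"]) (auto simp: Suc)
qed auto

lemma Ck_on_linear:
  assumes "bounded_linear L"
  shows "Ck_on k U L"
proof (cases k)
  case (Suc j)
  show ?thesis unfolding Suc
    by (rule Ck_on_SucI[of _ _ "\<lambda>z. L"])
      (auto simp: Ck_on_const bounded_linear_imp_has_derivative assms)
qed auto

lemma Ck_on_linear_comp:
  assumes "bounded_linear L" "Ck_on k U f"
  shows "Ck_on k U (\<lambda>z. L (f z))"
  using assms(2)
proof (induction k arbitrary: f)
  case (Suc k)
  then obtain f' where "\<forall>z\<in>U. (f has_derivative f' z) (at z)" "\<forall>v. Ck_on k U (\<lambda>z. f' z v)"
    by auto
  then show ?case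
    by (intro Ck_on_SucI[of _ _ "\<lambda>z v. L (f' z v)"])
      (auto intro: bounded_linear.has_derivative[OF assms(1)] Suc.IH)
qed auto

lemma Ck_on_inner_const: "Ck_on k U f \<Longrightarrow> Ck_on k U (\<lambda>z. f z \<bullet> b)"
  using Ck_on_linear_comp[OF bounded_linear_inner_left] .

lemma Ck_on_add:
  assumes "Ck_on k U f" "Ck_on k U g"
  shows "Ck_on k U (\<lambda>z. f z + g z)"
  using assms
proof (induction k arbitrary: f g)
  case (Suc k)
  then obtain f' g' where "\<forall>z\<in>U. (f has_derivative f' z) (at z)" "\<forall>v. Ck_on k U (\<lambda>z. f' z v)"
    "\<forall>z\<in>U. (g has_derivative g' z) (at z)" "\<forall>v. Ck_on k U (\<lambda>z. g' z v)"
    by auto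
  then show ?case
    by (intro Ck_on_SucI[of _ _ "\<lambda>z v. f' z v + g' z v"]) (auto intro: has_derivative_add Suc.IH)
qed auto

lemma Ck_on_sum:
  assumes "\<And>i. i \<in> I \<Longrightarrow> Ck_on k U (f i)"
  shows "Ck_on k U (\<lambda>z. \<Sum>i\<in>I. f i z)"
  using assms by (induction I rule: infinite_finite_induct) (auto intro: Ck_on_add Ck_on_const)

lemma Ck_on_scaleR:
  fixes f :: "'a::euclidean_space \<Rightarrow> real"
  assumes "Ck_on k U f" "Ck_on k U g"
  shows "Ck_on k U (\<lambda>z. f z *\<^sub>R g z)"
  using assms
proof (induction k arbitrary: f g)
  case (Suc k)
  then obtain f' g' where *: "\<forall>z\<in>U. (f has_derivative f' z) (at z)" "\<forall>v. Ck_on k U (\<lambda>z. f' z v)"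
    "\<forall>z\<in>U. (g has_derivative g' z) (at z)" "\<forall>v. Ck_on k U (\<lambda>z. g' z v)"
    by auto
  moreover have "Ck_on k U f" "Ck_on k U g"
    using Suc.prems Ck_on_SucD by blast+
  ultimately show ?case
    by (intro Ck_on_SucI[of _ _ "\<lambda>z v. f z *\<^sub>R g' z v + f' z v *\<^sub>R g z"])
      (auto intro!: has_derivative_scaleR Ck_on_add Suc.IH)
qed auto

lemma Ck_on_mult:
  fixes f g :: "'a::euclidean_space \<Rightarrow> real"
  assumes "Ck_on k U f" "Ck_on k U g"
  shows "Ck_on k U (\<lambda>z. f z * g z)"
  using Ck_on_scaleR[OF assms] by simp

lemma Ck_on_inverse:
  fixes f :: "'a::euclidean_space \<Rightarrow> real"
  assumes "Ck_on k U f" "\<And>z. z \<in> U \<Longrightarrow> f z \<noteq> 0"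
  shows "Ck_on k U (\<lambda>z. inverse (f z))"
  using assms(1)
proof (induction k)
  case (Suc k)
  then obtain f' where f': "\<forall>z\<in>U. (f has_derivative f' z) (at z)" "\<forall>v. Ck_on k U (\<lambda>z. f' z v)"
    by auto
  have IH: "Ck_on k U (\<lambda>z. inverse (f z))"
    using Suc Ck_on_SucD by blast
  show ?case
  proof (rule Ck_on_SucI)
    show "((\<lambda>z. inverse (f z)) has_derivative (\<lambda>v. (- 1) * (inverse (f z) * f' z v * inverse (f z)))) (at z)"
      if "z \<in> U" for z
      using Deriv.has_derivative_inverse[of f z "f' z" UNIV] f'(1) assms(2) that by auto
    show "Ck_on k U (\<lambda>z. (- 1) * (inverse (f z) * f' z v * inverse (f z)))" for v
      using f'(2) by (intro Ck_on_mult IH Ck_on_const) auto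
  qed
qed auto

lemma Ck_on_flat:
  assumes "Ck_on k U f"
  shows "Ck_on k U (\<lambda>z. flat P (f z))"
  using assms
proof (induction k arbitrary: P)
  case (Suc k)
  then obtain f' where f': "\<forall>z\<in>U. (f has_derivative f' z) (at z)" "\<forall>v. Ck_on k U (\<lambda>z. f' z v)"
    by auto
  show ?case
  proof (rule Ck_on_SucI)
    show "((\<lambda>z. flat P (f z)) has_derivative (\<lambda>v. flat (flat_deriv P) (f z) * f' z v)) (at z)"
      if "z \<in> U" for z
      using has_derivative_compose[of f "f' z" z UNIV "flat P"] f'(1) that flat_has_derivative[of P "f z"]
      by (auto simp: has_field_derivative_def)
    show "Ck_on k U (\<lambda>z. flat (flat_deriv P) (f z) * f' z v)" for v
      using f'(2) Suc.IH Ck_on_SucD[OF Suc.prems] by (intro Ck_on_mult) auto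
  qed
qed auto

text \<open>The chain rule applies g' (f z) to f' z v, a direction that moves with z, whereas
  \<open>Ck_on\<close> controls derivatives in fixed directions. Expanding f' z v in the basis
  reduces the first to the second.\<close>

lemma Ck_on_compose:
  fixes f :: "'a::euclidean_space \<Rightarrow> 'b::euclidean_space"
  assumes "Ck_on k U f" "Ck_on k UNIV g"
  shows "Ck_on k U (\<lambda>z. g (f z))"
  using assms
proof (induction k arbitrary: g)
  case (Suc k)
  then obtain f' g' where *: "\<forall>z\<in>U. (f has_derivative f' z) (at z)" "\<forall>v. Ck_on k U (\<lambda>z. f' z v)"
    "\<forall>z. (g has_derivative g' z) (at z)" "\<forall>v. Ck_on k UNIV (\<lambda>z. g' z v)"
    by auto
  show ?case
  proof (rule Ck_on_SucI)
    fix z assume z: "z \<in> U"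
    have "linear (g' (f z))"
      using *(3) has_derivative_linear by blast
    then have "g' (f z) (\<Sum>b\<in>Basis. (w \<bullet> b) *\<^sub>R b) = (\<Sum>b\<in>Basis. (w \<bullet> b) *\<^sub>R g' (f z) b)" for w
      by (simp add: linear_sum linear_scale)
    then have expand: "g' (f z) w = (\<Sum>b\<in>Basis. (w \<bullet> b) *\<^sub>R g' (f z) b)" for w
      unfolding euclidean_representation .
    have "(\<lambda>v. g' (f z) (f' z v)) = (\<lambda>v. \<Sum>b\<in>Basis. (f' z v \<bullet> b) *\<^sub>R g' (f z) b)"
      by (intro ext expand)
    moreover have "((\<lambda>z. g (f z)) has_derivative (\<lambda>v. g' (f z) (f' z v))) (at z)"
      using has_derivative_compose[of f "f' z" z UNIV g "g' (f z)"] *(1,3) z by auto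
    ultimately show "((\<lambda>z. g (f z)) has_derivative (\<lambda>v. \<Sum>b\<in>Basis. (f' z v \<bullet> b) *\<^sub>R g' (f z) b)) (at z)"
      by simp
  next
    show "Ck_on k U (\<lambda>z. \<Sum>b\<in>Basis. (f' z v \<bullet> b) *\<^sub>R g' (f z) b)" for v
    proof (intro Ck_on_sum Ck_on_scaleR Ck_on_inner_const)
      show "Ck_on k U (\<lambda>z. g' (f z) b)" for b
        by (rule Suc.IH[OF Ck_on_SucD[OF Suc.prems(1)] *(4)[rule_format]])
    qed (rule *(2)[rule_format])
  qed
qed auto

section \<open>Series of flat functions\<close>

text \<open>The weights 2^(-i) give uniform convergence for bounded coefficients. Vector
  coefficients are allowed so that the derivative in direction v is again a flat series, with
  coefficients (c_i . v) a_i.\<close>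

definition flat_series ::
  "(nat \<Rightarrow> 'a::euclidean_space) \<Rightarrow> (nat \<Rightarrow> real) \<Rightarrow> real poly \<Rightarrow> (nat \<Rightarrow> 'b::banach) \<Rightarrow> 'a \<Rightarrow> 'b" where
  "flat_series c d P a z = (\<Sum>i. ((1 / 2) ^ i * flat P (c i \<bullet> z - d i)) *\<^sub>R a i)"

lemma summable_flat_series_norm:
  assumes "\<And>i. norm (a i) \<le> A"
  shows "summable (\<lambda>i. norm (((1 / 2) ^ i * flat P (c i \<bullet> z - d i)) *\<^sub>R a i))"
proof -
  obtain B where B: "B > 0" "\<And>s. \<bar>flat P s\<bar> \<le> B"
    using flat_bounded by blast
  have "summable (\<lambda>i. (1 / 2) ^ i * (B * A) :: real)"
    by (intro summable_mult2 summable_geometric) auto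
  then show ?thesis
  proof (rule summable_comparison_test'[where N = 0])
    fix i
    have "(1 / 2) ^ i * \<bar>flat P (c i \<bullet> z - d i)\<bar> * norm (a i) \<le> (1 / 2) ^ i * (B * A)"
      unfolding mult.assoc using B assms[of i] by (intro mult_left_mono mult_mono) auto
    then show "norm (norm (((1 / 2) ^ i * flat P (c i \<bullet> z - d i)) *\<^sub>R a i)) \<le> (1 / 2) ^ i * (B * A)"
      by (simp add: abs_mult)
  qed
qed

lemma summable_flat_series:
  fixes a :: "nat \<Rightarrow> 'b::banach"
  assumes "\<And>i. norm (a i) \<le> A"
  shows "summable (\<lambda>i. ((1 / 2) ^ i * flat P (c i \<bullet> z - d i)) *\<^sub>R a i)"
  using summable_norm_cancel[OF summable_flat_series_norm[of a A P c z d]] assms by blast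

lemma flat_series_inner:
  assumes "\<And>i. norm (a i) \<le> A"
  shows "flat_series c d P a z \<bullet> v = flat_series c d P (\<lambda>i. a i \<bullet> v) z"
  using bounded_linear.suminf[OF bounded_linear_inner_left summable_flat_series[of a A P c z d], of v] assms
  by (simp add: flat_series_def)

text \<open>The weights from index n on add up to 2 (1 / 2)^n. The bound is uniform in z, as
  termwise differentiation requires.\<close>

lemma norm_flat_series_tail:
  assumes "\<And>s. \<bar>flat P s\<bar> \<le> B" "\<And>i. norm (a i) \<le> A"
  shows "norm ((\<Sum>i<n. ((1 / 2) ^ i * flat P (c i \<bullet> z - d i)) *\<^sub>R a i) - flat_series c d P a z)
    \<le> 2 * (1 / 2) ^ n * (B * A)"
proof -
  let ?f = "\<lambda>i. ((1 / 2) ^ i * flat P (c i \<bullet> z - d i)) *\<^sub>R a i"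
  have B: "B \<ge> 0" using assms(1)[of 0] by linarith
  have sm: "summable ?f"
    by (rule summable_flat_series, rule assms(2))
  have smn: "summable (\<lambda>i. norm (?f i))"
    by (rule summable_flat_series_norm, rule assms(2))
  have "norm ((\<Sum>i<n. ?f i) - flat_series c d P a z) = norm (\<Sum>i. ?f (i + n))"
    unfolding flat_series_def suminf_split_initial_segment[OF sm, where k = n]
    by simp
  also have "\<dots> \<le> (\<Sum>i. norm (?f (i + n)))"
    by (intro summable_norm summable_ignore_initial_segment smn)
  also have "\<dots> \<le> (\<Sum>i. (1 / 2) ^ i * ((1 / 2) ^ n * (B * A)))"
  proof (rule suminf_le)
    fix i
    have "(1 / 2) ^ (i + n) * \<bar>flat P (c (i + n) \<bullet> z - d (i + n))\<bar> * norm (a (i + n))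
        \<le> (1 / 2) ^ (i + n) * (B * A)"
      unfolding mult.assoc using B assms by (intro mult_left_mono mult_mono) auto
    then show "norm (?f (i + n)) \<le> (1 / 2) ^ i * ((1 / 2) ^ n * (B * A))"
      by (simp add: abs_mult power_add)
  next
    show "summable (\<lambda>i. norm (?f (i + n)))"
      by (rule summable_ignore_initial_segment[OF smn])
  qed (intro summable_mult2 summable_geometric, simp)
  also have "\<dots> = 2 * (1 / 2) ^ n * (B * A)"
    by (subst suminf_mult2[symmetric]) (auto simp: suminf_geometric intro: summable_geometric)
  finally show ?thesis .
qed

text \<open>Termwise differentiation: the partial sums of the derivatives converge uniformly in z,
  with an error proportional to |v| because |c_i . v| <= |v|.\<close>

lemma flat_series_has_derivative:
  assumes "\<And>i. norm (c i) \<le> 1" "\<And>i. norm (a i) \<le> A"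
  shows "(flat_series c d P a has_derivative
    (\<lambda>v. flat_series c d (flat_deriv P) (\<lambda>i. (c i \<bullet> v) *\<^sub>R a i) z)) (at z)"
proof -
  let ?f = "\<lambda>i z. ((1 / 2) ^ i * flat P (c i \<bullet> z - d i)) *\<^sub>R a i"
  let ?f' = "\<lambda>i z v. ((1 / 2) ^ i * flat (flat_deriv P) (c i \<bullet> z - d i)) *\<^sub>R ((c i \<bullet> v) *\<^sub>R a i)"
  obtain B where B: "B > 0" "\<And>s. \<bar>flat (flat_deriv P) s\<bar> \<le> B"
    using flat_bounded by blast
  have A: "A \<ge> 0" using assms(2)[of 0] norm_ge_zero order_trans by blast
  have "\<exists>g. \<forall>z\<in>UNIV. (\<lambda>i. ?f i z) sums (g z) \<and>
      (g has_derivative (\<lambda>v. flat_series c d (flat_deriv P) (\<lambda>i. (c i \<bullet> v) *\<^sub>R a i) z)) (at z within UNIV)"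
  proof (rule has_derivative_series[where f' = ?f' and x = z])
    fix i :: nat and x :: 'a
    have "((\<lambda>z. flat P (c i \<bullet> z - d i)) has_derivative (\<lambda>v. flat (flat_deriv P) (c i \<bullet> x - d i) * (c i \<bullet> v))) (at x)"
    proof (rule has_derivative_compose[where g = "flat P" and f = "\<lambda>z. c i \<bullet> z - d i"
            and g' = "(*) (flat (flat_deriv P) (c i \<bullet> x - d i))" and f' = "\<lambda>v. c i \<bullet> v"])
      show "((\<lambda>z. c i \<bullet> z - d i) has_derivative (\<lambda>v. c i \<bullet> v)) (at x)"
        by (auto intro!: derivative_eq_intros)
      show "(flat P has_derivative (*) (flat (flat_deriv P) (c i \<bullet> x - d i))) (at (c i \<bullet> x - d i))"
        using flat_has_derivative by (simp add: has_field_derivative_def)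
    qed
    then show "(?f i has_derivative ?f' i x) (at x within UNIV)"
      by (auto intro!: derivative_eq_intros)
  next
    fix \<epsilon> :: real assume \<epsilon>: "\<epsilon> > 0"
    have "(\<lambda>n. 2 * (1 / 2) ^ n * (B * A)) \<longlonglongrightarrow> 2 * 0 * (B * A)"
      by (intro tendsto_intros LIMSEQ_power_zero) auto
    then have "\<forall>\<^sub>F n in sequentially. 2 * (1 / 2) ^ n * (B * A) < \<epsilon>"
      using \<epsilon> by (auto dest: order_tendstoD)
    then show "\<forall>\<^sub>F n in sequentially. \<forall>x\<in>UNIV. \<forall>v.
        norm ((\<Sum>i<n. ?f' i x v) - flat_series c d (flat_deriv P) (\<lambda>i. (c i \<bullet> v) *\<^sub>R a i) x) \<le> \<epsilon> * norm v"
    proof eventually_elim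
      case (elim n)
      show ?case
      proof (intro ballI allI)
        fix x v :: 'a
        have "norm ((c i \<bullet> v) *\<^sub>R a i) \<le> norm v * A" for i
        proof -
          have "\<bar>c i \<bullet> v\<bar> \<le> norm v"
            using Cauchy_Schwarz_ineq2[of "c i" v] mult_right_mono[OF assms(1)[of i], of "norm v"] by simp
          then show ?thesis using assms(2)[of i] by (simp add: mult_mono)
        qed
        from norm_flat_series_tail[OF B(2) this]
        have "norm ((\<Sum>i<n. ?f' i x v) - flat_series c d (flat_deriv P) (\<lambda>i. (c i \<bullet> v) *\<^sub>R a i) x)
            \<le> 2 * (1 / 2) ^ n * (B * A) * norm v"
          by (simp add: mult_ac)
        also have "\<dots> \<le> \<epsilon> * norm v"
          using elim by (intro mult_right_mono) auto
        finally show "norm ((\<Sum>i<n. ?f' i x v) - flat_series c d (flat_deriv P) (\<lambda>i. (c i \<bullet> v) *\<^sub>R a i) x)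
            \<le> \<epsilon> * norm v" .
      qed
    qed
  next
    show "(\<lambda>i. ?f i z) sums flat_series c d P a z"
      unfolding flat_series_def by (rule summable_sums, rule summable_flat_series, rule assms(2))
  qed auto
  then obtain g where g: "\<And>z. (\<lambda>i. ?f i z) sums (g z)"
    "\<And>z. (g has_derivative (\<lambda>v. flat_series c d (flat_deriv P) (\<lambda>i. (c i \<bullet> v) *\<^sub>R a i) z)) (at z)"
    by auto
  have "g = flat_series c d P a"
    using g(1) by (auto simp: flat_series_def sums_iff)
  with g(2) show ?thesis by simp
qed

lemma Ck_on_flat_series:
  assumes "\<And>i. norm (c i) \<le> 1" "\<And>i. norm (a i) \<le> A"
  shows "Ck_on k UNIV (flat_series c d P a)"
  using assms(2)
proof (induction k arbitrary: P a A)
  case (Suc k)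
  show ?case
  proof (rule Ck_on_SucI)
    show "Ck_on k UNIV (\<lambda>z. flat_series c d (flat_deriv P) (\<lambda>i. (c i \<bullet> v) *\<^sub>R a i) z)" for v
    proof (rule Suc.IH)
      fix i
      have "\<bar>c i \<bullet> v\<bar> \<le> norm v"
        using Cauchy_Schwarz_ineq2[of "c i" v] mult_right_mono[OF assms(1)[of i], of "norm v"] by simp
      then show "norm ((c i \<bullet> v) *\<^sub>R a i) \<le> norm v * A"
        using Suc.prems[of i] by (simp add: mult_mono)
    qed
  qed (rule flat_series_has_derivative[OF assms(1) Suc.prems])
qed auto

section \<open>Curvature as the determinant of a Weingarten map\<close>

text \<open>The segment from \<open>A\<close> to the identity consists of nonsingular matrices, apart from \<open>A\<close> itself.\<close>
lemma det_nonneg_if_positive_semidefinite: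
  fixes A :: "real^'n^'n"
  assumes "\<And>v. 0 \<le> v \<bullet> (A *v v)"
  shows "0 \<le> det A"
proof (rule ccontr)
  assume neg: "\<not> 0 \<le> det A"
  define M where "M s = (1 - s) *\<^sub>R A + s *\<^sub>R mat 1" for s
  have "continuous_on {0..1} (\<lambda>s. det (M s))"
    unfolding det_def M_def by (intro continuous_intros)
  moreover have "det (M 0) \<le> 0" "0 \<le> det (M 1)"
    using neg by (auto simp: M_def)
  ultimately obtain s where s: "0 \<le> s" "s \<le> 1" "det (M s) = 0"
    using IVT'[of "\<lambda>s. det (M s)" 0 0 1] by auto
  then have "s > 0" using neg by (cases "s = 0") (auto simp: M_def)
  have "\<not> (\<exists>B. B ** M s = mat 1)"
    using s(3) by (metis invertible_det_nz invertible_left_inverse)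
  then obtain v where v: "M s *v v = 0" "v \<noteq> 0"
    unfolding matrix_left_invertible_ker by blast
  have "0 = v \<bullet> (M s *v v)" using v by simp
  also have "\<dots> = (1 - s) * (v \<bullet> (A *v v)) + s * (v \<bullet> v)"
    by (simp add: M_def matrix_vector_mult_add_rdistrib inner_add_right scaleR_matrix_vector_assoc[symmetric])
  also have "\<dots> > 0"
    using \<open>s > 0\<close> s v(2) assms[of v] by (intro add_nonneg_pos) auto
  finally show False by simp
qed

lemma linear_ext_map:
  assumes "linear L"
  shows "linear (ext_map p L w)"
  unfolding ext_map_def
  by (intro linearI) (simp_all add: linear_add[OF assms] linear_diff[OF assms] linear_scale[OF assms] algebra_simps)

lemma det_matrix_eq_0_iff:
  fixes L :: "real^'n \<Rightarrow> real^'n"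
  assumes "linear L"
  shows "det (matrix L) = 0 \<longleftrightarrow> (\<exists>v. v \<noteq> 0 \<and> L v = 0)"
proof -
  have "det (matrix L) = 0 \<longleftrightarrow> \<not> (\<exists>B. B ** matrix L = mat 1)"
    by (metis invertible_det_nz invertible_left_inverse)
  also have "\<dots> \<longleftrightarrow> (\<exists>v. v \<noteq> 0 \<and> L v = 0)"
    unfolding matrix_left_invertible_ker using assms by auto
  finally show ?thesis .
qed

text \<open>With X' = dx and dN = L o X', the numerator map is \<open>ext_map \<nu> L \<nu>\<close>
  after the denominator map, and determinants multiply. So the quotient in \<open>GK_curv\<close>
  depends only on L and the normal, not on the parametrisation.\<close>

lemma det_ext_map_quotient:
  fixes X' L :: "real^'n \<Rightarrow> real^'n"
  assumes "linear X'" "linear L" "norm p = 1" "norm \<nu> = 1"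
    and inj: "\<And>v. v \<in> tang p \<Longrightarrow> X' v = 0 \<Longrightarrow> v = 0"
    and tan: "\<And>v. v \<in> tang p \<Longrightarrow> X' v \<bullet> \<nu> = 0"
  shows "det (matrix (ext_map p (\<lambda>v. L (X' v)) \<nu>)) / det (matrix (ext_map p X' \<nu>)) =
    det (matrix (ext_map \<nu> L \<nu>))"
proof -
  have unit: "p \<bullet> p = 1" "\<nu> \<bullet> \<nu> = 1" using assms(3,4) by (simp_all add: dot_square_norm)
  have proj: "v - (v \<bullet> p) *\<^sub>R p \<in> tang p" for v
    by (simp add: tang_def inner_diff_left unit)
  \<comment> \<open>The extension turns the p-component of v into the \<nu>-component of its image;
    this is why the two extensions compose.\<close>
  have dot: "ext_map p X' \<nu> v \<bullet> \<nu> = v \<bullet> p" for v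
    using tan[OF proj[of v]] by (simp add: ext_map_def inner_add_left unit)
  have "ext_map p (\<lambda>v. L (X' v)) \<nu> v = ext_map \<nu> L \<nu> (ext_map p X' \<nu> v)" for v
  proof -
    have "ext_map p X' \<nu> v - (ext_map p X' \<nu> v \<bullet> \<nu>) *\<^sub>R \<nu> = X' (v - (v \<bullet> p) *\<^sub>R p)"
      unfolding dot by (simp add: ext_map_def)
    then show ?thesis
      unfolding ext_map_def[of \<nu> L \<nu>] by (simp add: dot) (simp add: ext_map_def)
  qed
  then have "ext_map p (\<lambda>v. L (X' v)) \<nu> = ext_map \<nu> L \<nu> \<circ> ext_map p X' \<nu>" by auto
  then have "det (matrix (ext_map p (\<lambda>v. L (X' v)) \<nu>)) =
      det (matrix (ext_map \<nu> L \<nu>)) * det (matrix (ext_map p X' \<nu>))"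
    by (simp add: matrix_compose linear_ext_map assms det_mul)
  moreover have "det (matrix (ext_map p X' \<nu>)) \<noteq> 0"
  proof
    assume "det (matrix (ext_map p X' \<nu>)) = 0"
    then obtain v where v: "v \<noteq> 0" "ext_map p X' \<nu> v = 0"
      using det_matrix_eq_0_iff[OF linear_ext_map[OF assms(1)]] by blast
    then have "v \<bullet> p = 0" using dot[of v] by simp
    with v inj[of v] show False by (simp add: ext_map_def tang_def)
  qed
  ultimately show ?thesis by simp
qed

text \<open>The extended map is L on the tangent hyperplane plus the identity on the line of \<nu>.
  Its quadratic form is that of L on the tangential part plus (v . \<nu>)^2, and its kernel is
  tangential.\<close>

lemma det_ext_map_normal:
  fixes L :: "real^'n \<Rightarrow> real^'n"
  assumes "linear L" "norm \<nu> = 1" "\<And>v. L v \<bullet> \<nu> = 0"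
    and psd: "\<And>v. v \<in> tang \<nu> \<Longrightarrow> 0 \<le> L v \<bullet> v"
  shows "0 \<le> det (matrix (ext_map \<nu> L \<nu>))"
    and "det (matrix (ext_map \<nu> L \<nu>)) = 0 \<longleftrightarrow> (\<exists>v\<in>tang \<nu>. v \<noteq> 0 \<and> L v = 0)"
proof -
  have unit: "\<nu> \<bullet> \<nu> = 1" using assms(2) by (simp add: dot_square_norm)
  have lin: "linear (ext_map \<nu> L \<nu>)" using linear_ext_map assms(1) by blast
  show "0 \<le> det (matrix (ext_map \<nu> L \<nu>))"
  proof (rule det_nonneg_if_positive_semidefinite)
    fix v
    let ?w = "v - (v \<bullet> \<nu>) *\<^sub>R \<nu>"
    have "0 \<le> L ?w \<bullet> ?w" by (rule psd) (simp add: tang_def inner_diff_left unit)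
    also have "\<dots> = L ?w \<bullet> v" by (simp add: inner_diff_right assms(3))
    finally have "0 \<le> v \<bullet> ext_map \<nu> L \<nu> v"
      by (simp add: ext_map_def inner_add_right inner_commute)
    then show "0 \<le> v \<bullet> (matrix (ext_map \<nu> L \<nu>) *v v)"
      using lin by simp
  qed
  have "(\<exists>v. v \<noteq> 0 \<and> ext_map \<nu> L \<nu> v = 0) \<longleftrightarrow> (\<exists>v\<in>tang \<nu>. v \<noteq> 0 \<and> L v = 0)"
  proof
    assume "\<exists>v. v \<noteq> 0 \<and> ext_map \<nu> L \<nu> v = 0"
    then obtain v where v: "v \<noteq> 0" "ext_map \<nu> L \<nu> v = 0" by blast
    have "ext_map \<nu> L \<nu> v \<bullet> \<nu> = v \<bullet> \<nu>"
      by (simp add: ext_map_def inner_add_left unit assms(3))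
    with v have "v \<bullet> \<nu> = 0" by simp
    with v show "\<exists>v\<in>tang \<nu>. v \<noteq> 0 \<and> L v = 0" by (auto simp: ext_map_def tang_def)
  next
    assume "\<exists>v\<in>tang \<nu>. v \<noteq> 0 \<and> L v = 0"
    then obtain v where "v \<noteq> 0" "L v = 0" "v \<bullet> \<nu> = 0" by (auto simp: tang_def)
    then have "ext_map \<nu> L \<nu> v = 0" by (simp add: ext_map_def)
    with \<open>v \<noteq> 0\<close> show "\<exists>v. v \<noteq> 0 \<and> ext_map \<nu> L \<nu> v = 0" by blast
  qed
  then show "det (matrix (ext_map \<nu> L \<nu>)) = 0 \<longleftrightarrow> (\<exists>v\<in>tang \<nu>. v \<noteq> 0 \<and> L v = 0)"
    using det_matrix_eq_0_iff[OF lin] by simp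
qed

section \<open>Ranks of linear maps on tangent hyperplanes\<close>

lemma dim_orthogonal_set:
  fixes S :: "(real^'n) set"
  shows "dim {y. \<forall>x\<in>S. x \<bullet> y = 0} + dim S = CARD('n)"
proof -
  have "dim {y. \<forall>x\<in>span S. orthogonal x y} + dim (span S) = CARD('n)"
    using dim_subspace_orthogonal_to_vectors[of "span S" UNIV] by simp
  moreover have "{y. \<forall>x\<in>span S. orthogonal x y} = {y. \<forall>x\<in>S. x \<bullet> y = 0}"
    (is "?l = ?r")
  proof
    show "?l \<subseteq> ?r" using span_base[of _ S] by (auto simp: orthogonal_def)
    show "?r \<subseteq> ?l"
      using orthogonal_to_span[of _ S] orthogonal_commute unfolding orthogonal_def[symmetric] by blast
  qed
  ultimately show ?thesis by simp
qed

lemma subspace_tang: "subspace (tang p)"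
  by (auto simp: tang_def subspace_def inner_add_left)

lemma dim_tang:
  fixes p :: "real^'n"
  assumes "p \<noteq> 0"
  shows "dim (tang p) + 1 = CARD('n)"
proof -
  have "dim {p} = 1" using assms by (simp add: dim_insert)
  moreover have "{y. \<forall>x\<in>{p}. x \<bullet> y = 0} = tang p" by (auto simp: tang_def inner_commute)
  ultimately show ?thesis using dim_orthogonal_set[of "{p}"] by metis
qed

text \<open>An injective image of one hyperplane inside another fills it, by dimension. Hence the
  rank of dN can be computed on the tangent space of the image hypersurface.\<close>

lemma image_tang_eq:
  fixes X' :: "real^'n \<Rightarrow> real^'n"
  assumes "linear X'" "norm p = 1" "norm \<nu> = 1"
    and inj: "\<And>v. v \<in> tang p \<Longrightarrow> X' v = 0 \<Longrightarrow> v = 0"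
    and tan: "\<And>v. v \<in> tang p \<Longrightarrow> X' v \<bullet> \<nu> = 0"
  shows "X' ` tang p = tang \<nu>"
proof (rule subspace_dim_equal)
  have "inj_on X' (tang p)"
    using inj by (subst linear_inj_on_iff_eq_0[OF assms(1) subspace_tang]) auto
  then have "dim (X' ` tang p) = dim (tang p)"
    using dim_image_eq[OF assms(1)] subspace_tang by (metis span_eq_iff)
  moreover have "p \<noteq> 0" "\<nu> \<noteq> 0" using assms(2,3) by auto
  ultimately show "dim (tang \<nu>) \<le> dim (X' ` tang p)"
    using dim_tang[of p] dim_tang[of \<nu>] by simp
qed (use tan in \<open>auto simp: tang_def intro: linear_subspace_image assms(1) subspace_tang[unfolded tang_def]\<close>)

text \<open>L is injective on the orthogonal complement of \<nu> and e, whose dimension is at least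
  \<open>CARD('n) - 2\<close> even if the two vectors are dependent.\<close>

lemma dim_image_tang_ge:
  fixes L :: "real^'n \<Rightarrow> real^'n"
  assumes "linear L" "\<And>v. v \<bullet> \<nu> = 0 \<Longrightarrow> v \<bullet> e = 0 \<Longrightarrow> L v = 0 \<Longrightarrow> v = 0"
  shows "CARD('n) - 2 \<le> dim (L ` tang \<nu>)"
proof -
  let ?S = "{y. \<forall>x\<in>{\<nu>, e}. x \<bullet> y = 0}"
  have sub: "subspace ?S" by (auto simp: subspace_def inner_add_right)
  have "inj_on L ?S"
    using assms(2) by (subst linear_inj_on_iff_eq_0[OF assms(1) sub]) (auto simp: inner_commute)
  moreover have "span ?S = ?S"
    using sub by (simp only: span_eq_iff)
  ultimately have "dim (L ` ?S) = dim ?S"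
    using dim_image_eq[OF assms(1), of ?S] by argo
  moreover have "dim {\<nu>, e} \<le> 2"
    using dim_le_card'[of "{\<nu>, e}"] card_insert_le_m1[of 2 "{e}" \<nu>] by simp
  moreover have "dim (L ` ?S) \<le> dim (L ` tang \<nu>)"
    by (intro dim_subset image_mono) (auto simp: tang_def inner_commute)
  ultimately show ?thesis using dim_orthogonal_set[of "{\<nu>, e}"] by linarith
qed

lemma dim_image_tang_le:
  fixes L :: "real^'n \<Rightarrow> real^'n"
  assumes "norm \<nu> = 1" "norm e = 1" "\<nu> \<bullet> e = 0"
    and "\<And>v. v \<in> tang \<nu> \<Longrightarrow> L v \<bullet> \<nu> = 0 \<and> L v \<bullet> e = 0"
  shows "dim (L ` tang \<nu>) \<le> CARD('n) - 2"
proof -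
  have nz: "\<nu> \<noteq> 0" "e \<noteq> 0" "\<nu> \<noteq> e" using assms(1-3) by auto
  then have "independent {\<nu>, e}"
    using assms(3) by (intro pairwise_orthogonal_independent) (auto simp: pairwise_def orthogonal_def inner_commute)
  then have "dim {\<nu>, e} = 2"
    using nz by (subst dim_eq_card_independent) auto
  moreover have "dim (L ` tang \<nu>) \<le> dim {y. \<forall>x\<in>{\<nu>, e}. x \<bullet> y = 0}"
    using assms(4) by (intro dim_subset) (auto simp: inner_commute)
  ultimately show ?thesis using dim_orthogonal_set[of "{\<nu>, e}"] by linarith
qed

text \<open>Normalising a field removes from its derivative the component along the field. Applied
  to the gradient of a defining function, this differentiates the Gauss map.\<close>

lemma has_derivative_sgn:
  fixes g :: "'a::real_normed_vector \<Rightarrow> 'b::real_inner"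
  assumes g: "(g has_derivative H) (at z)" and nz: "g z \<noteq> 0"
  shows "((\<lambda>z. sgn (g z)) has_derivative
    (\<lambda>v. (1 / norm (g z)) *\<^sub>R (H v - (H v \<bullet> sgn (g z)) *\<^sub>R sgn (g z)))) (at z)"
proof -
  have n: "((\<lambda>z. norm (g z)) has_derivative (\<lambda>v. H v \<bullet> sgn (g z))) (at z)"
    using has_derivative_compose[OF g, of norm "\<lambda>h. h \<bullet> sgn (g z)"] has_derivative_norm[OF nz]
    by simp
  have "((\<lambda>z. inverse (norm (g z)) *\<^sub>R g z) has_derivative
    (\<lambda>v. (1 / norm (g z)) *\<^sub>R (H v - (H v \<bullet> sgn (g z)) *\<^sub>R sgn (g z)))) (at z)"
    using nz
    by (auto intro!: derivative_eq_intros n g simp: sgn_div_norm divide_inverse algebra_simps)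
  then show ?thesis by (simp add: sgn_div_norm divide_inverse_commute)
qed

section \<open>Star-shaped level sets\<close>

text \<open>Differentiability of the radial function comes from the inverse of \<open>(r, p) \<mapsto> (G (r *\<^sub>R p), p)\<close>.
  The formula for its derivative contains only the radial function itself and derivatives of \<open>G\<close>,
  which gives one more derivative at each step.\<close>
lemma star_shaped_level_set:
  fixes G :: "'a::euclidean_space \<Rightarrow> real" and g :: "'a \<Rightarrow> 'a"
  assumes smooth: "\<And>k. Ck_on k UNIV G"
    and G': "\<And>z. (G has_derivative (\<lambda>v. g z \<bullet> v)) (at z)"
    and nonneg: "\<And>z. 0 \<le> g z \<bullet> z"
    and pos: "\<And>z. 0 < G z \<Longrightarrow> 0 < g z \<bullet> z"
    and s: "0 < s"
    and ex: "\<And>p. p \<noteq> 0 \<Longrightarrow> \<exists>r>0. G (r *\<^sub>R p) = s"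
  obtains \<rho> where "\<And>p. p \<noteq> 0 \<Longrightarrow> 0 < \<rho> p"
    "\<And>p. p \<noteq> 0 \<Longrightarrow> G (\<rho> p *\<^sub>R p) = s"
    "\<And>p r. 0 < r \<Longrightarrow> G (r *\<^sub>R p) = s \<Longrightarrow> \<rho> p = r"
    "\<And>k. Ck_on k (- {0}) \<rho>"
proof -
  have ray: "((\<lambda>r. G (r *\<^sub>R p)) has_real_derivative (g (r *\<^sub>R p) \<bullet> p)) (at r)" for r p
  proof -
    have "((\<lambda>r. G (r *\<^sub>R p)) has_derivative (\<lambda>h. g (r *\<^sub>R p) \<bullet> (h *\<^sub>R p))) (at r)"
      by (rule has_derivative_compose[where f = "\<lambda>r. r *\<^sub>R p", OF _ G']) (auto intro!: derivative_eq_intros)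
    then show ?thesis by (simp add: has_field_derivative_def mult_commute_abs)
  qed
  have ray_nonneg: "0 \<le> g (r *\<^sub>R p) \<bullet> p" if "r > 0" for r p
    using nonneg[of "r *\<^sub>R p"] that by (simp add: zero_le_mult_iff)
  have ray_pos: "0 < g (r *\<^sub>R p) \<bullet> p" if "r > 0" "0 < G (r *\<^sub>R p)" for r p
    using pos[of "r *\<^sub>R p"] that by (simp add: zero_less_mult_iff)
  have mono: "G (r *\<^sub>R p) \<le> G (t *\<^sub>R p)" if "0 < r" "r \<le> t" for r t p
  proof (rule DERIV_nonneg_imp_nondecreasing[OF that(2)])
    show "\<exists>y. ((\<lambda>r. G (r *\<^sub>R p)) has_real_derivative y) (at u) \<and> 0 \<le> y" if "r \<le> u" for u
      using ray[of p u] ray_nonneg[of u p] that \<open>0 < r\<close> by auto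
  qed
  \<comment> \<open>By the mean value theorem, equal values force a zero of the radial derivative in
    between, where G is still positive by monotonicity.\<close>
  have strict: "G (r *\<^sub>R p) \<noteq> G (t *\<^sub>R p)" if "0 < r" "r < t" "0 < G (r *\<^sub>R p)" for r t p
  proof
    assume eq: "G (r *\<^sub>R p) = G (t *\<^sub>R p)"
    note rt = that
    obtain u where u: "r < u" "u < t"
      "G (t *\<^sub>R p) - G (r *\<^sub>R p) = (t - r) * (g (u *\<^sub>R p) \<bullet> p)"
      using MVT2[OF rt(2), of "\<lambda>r. G (r *\<^sub>R p)" "\<lambda>r. g (r *\<^sub>R p) \<bullet> p", OF ray] by blast
    then have "g (u *\<^sub>R p) \<bullet> p = 0" using eq by simp
    moreover have "0 < G (u *\<^sub>R p)" using mono[of r u p] that u(1) by simp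
    ultimately show False using ray_pos[of u p] u(1) that(1) by simp
  qed
  have unique: "r = t" if "0 < r" "0 < t" "G (r *\<^sub>R p) = G (t *\<^sub>R p)" "0 < G (r *\<^sub>R p)" for r t p
    using strict[of r t p] strict[of t r p] that by (cases r t rule: linorder_cases) auto
  define \<rho> where "\<rho> p = (SOME r. 0 < r \<and> G (r *\<^sub>R p) = s)" for p
  have \<rho>: "0 < \<rho> p \<and> G (\<rho> p *\<^sub>R p) = s" if "p \<noteq> 0" for p
    unfolding \<rho>_def using ex[OF that] by (intro someI_ex[where P = "\<lambda>r. 0 < r \<and> G (r *\<^sub>R p) = s"]) auto
  \<comment> \<open>At 0 the conclusion of \<open>pos\<close> would read 0 < 0, so G is not positive
    there. This excludes p = 0 in the uniqueness of the radius.\<close>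
  have G0: "G 0 \<le> 0" using pos[of 0] by force
  have \<rho>_unique: "\<rho> p = r" if "0 < r" "G (r *\<^sub>R p) = s" for p r
  proof -
    have "p \<noteq> 0" using that G0 s by auto
    then show ?thesis using \<rho>[of p] unique[of "\<rho> p" r p] that s by auto
  qed

  \<comment> \<open>On this open set f is injective, because G determines the radius on a ray
    wherever it is positive. The value \<rho> p is the first component of the inverse at (s,
    p).\<close>
  define S where "S = {y. 0 < fst y \<and> 0 < G (fst y *\<^sub>R (snd y :: 'a))}"
  define f where "f y = (G (fst y *\<^sub>R snd y), snd y)" for y :: "real \<times> 'a"
  have f': "(f has_derivative (\<lambda>y. (g (r *\<^sub>R p) \<bullet> (r *\<^sub>R snd y + fst y *\<^sub>R p), snd y))) (at (r, p))" for r p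
  proof -
    have "((\<lambda>y. G (fst y *\<^sub>R snd y)) has_derivative (\<lambda>y. g (r *\<^sub>R p) \<bullet> (r *\<^sub>R snd y + fst y *\<^sub>R p))) (at (r, p))"
      by (rule has_derivative_compose[where f = "\<lambda>y. fst y *\<^sub>R snd y" and g = G])
        (use G'[of "r *\<^sub>R p"] in \<open>auto intro!: derivative_eq_intros\<close>)
    then show ?thesis unfolding f_def by (auto intro!: derivative_eq_intros)
  qed
  have contG: "continuous_on UNIV G"
    using G' by (meson continuous_at_imp_continuous_on has_derivative_continuous)
  have "open S"
  proof -
    have "continuous_on UNIV (\<lambda>y. G (fst y *\<^sub>R (snd y :: 'a)))"
      by (intro continuous_on_compose2[OF contG] continuous_intros) auto
    then show ?thesis
      unfolding S_def by (intro open_Collect_conj open_Collect_less continuous_intros)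
  qed
  have contf: "continuous_on S f"
    using has_derivative_continuous[OF f'] by (intro continuous_at_imp_continuous_on ballI) auto
  have injf: "inj_on f S"
    by (auto simp: inj_on_def f_def S_def intro: unique)
  define gi where "gi = inv_into S f"
  have gf: "gi (f y) = y" if "y \<in> S" for y
    unfolding gi_def using inv_into_f_f[OF injf that] .
  have \<rho>S: "(\<rho> p, p) \<in> S" "f (\<rho> p, p) = (s, p)" if "p \<noteq> 0" for p
    using \<rho>[OF that] s by (auto simp: S_def f_def)
  have \<rho>': "(\<rho> has_derivative (\<lambda>v. (- 1) * (\<rho> p * (g (\<rho> p *\<^sub>R p) \<bullet> v) * inverse (g (\<rho> p *\<^sub>R p) \<bullet> p)))) (at p)"
    (is "(\<rho> has_derivative ?D) _") if p: "p \<noteq> 0" for p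
  proof -
    let ?a = "g (\<rho> p *\<^sub>R p)"
    have a: "?a \<bullet> p \<noteq> 0" using ray_pos[of "\<rho> p" p] \<rho>[OF p] s by simp
    \<comment> \<open>The inverse of the derivative of f at (\<rho> p, p): it solves a = \<rho> p (g
      . q) + b (g . p) for b. Setting a = 0 gives the derivative of \<rho>.\<close>
    let ?g' = "\<lambda>y. ((fst y - \<rho> p * (?a \<bullet> snd y)) / (?a \<bullet> p), snd y :: 'a)"
    have "(gi has_derivative ?g') (at (f (\<rho> p, p)))"
      by (rule has_derivative_inverse_strong[OF \<open>open S\<close> \<rho>S(1)[OF p] contf gf f'])
        (use a in \<open>auto simp: fun_eq_iff inner_add_right\<close>)
    then have gi': "(gi has_derivative ?g') (at (s, p))"
      using \<rho>S(2)[OF p] by simp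
    have "((\<lambda>q. gi (s, q)) has_derivative (\<lambda>v. ?g' (0, v))) (at p)"
      by (rule has_derivative_compose[where f = "\<lambda>q. (s, q)" and g = gi, OF _ gi'])
        (auto intro!: derivative_eq_intros)
    then have "((\<lambda>q. fst (gi (s, q))) has_derivative (\<lambda>v. fst (?g' (0, v)))) (at p)"
      by (rule has_derivative_fst)
    then have "((\<lambda>q. fst (gi (s, q))) has_derivative ?D) (at p)"
      by (simp add: divide_inverse)
    moreover have "fst (gi (s, q)) = \<rho> q" if "q \<in> - {0}" for q
      using gf[OF \<rho>S(1)[of q]] \<rho>S(2)[of q] that by simp
    ultimately show ?thesis
      using has_derivative_transform_within_open[of _ ?D p UNIV "- {0}" \<rho>] p by auto
  qed
  have "Ck_on k (- {0}) \<rho>" for k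
  proof (induction k)
    case (Suc k)
    have X: "Ck_on k (- {0}) (\<lambda>p. \<rho> p *\<^sub>R p)"
      by (intro Ck_on_scaleR Suc Ck_on_linear bounded_linear_ident)
    have g: "Ck_on k (- {0}) (\<lambda>p. g (\<rho> p *\<^sub>R p) \<bullet> v)" for v
      by (rule Ck_on_compose[OF X, of "\<lambda>z. g z \<bullet> v"])
        (rule Ck_on_deriv[OF open_UNIV smooth G'])
    \<comment> \<open>Here the direction p varies with the base point, so the inner product is
      expanded in the basis.\<close>
    have gp: "Ck_on k (- {0}) (\<lambda>p. g (\<rho> p *\<^sub>R p) \<bullet> p)"
      by (subst euclidean_inner)
        (intro Ck_on_sum Ck_on_mult g Ck_on_inner_const Ck_on_linear bounded_linear_ident)
    show ?case
    proof (rule Ck_on_SucI[OF \<rho>'])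
      show "Ck_on k (- {0}) (\<lambda>p. (- 1) * (\<rho> p * (g (\<rho> p *\<^sub>R p) \<bullet> v) * inverse (g (\<rho> p *\<^sub>R p) \<bullet> p)))" for v
      proof (intro Ck_on_mult Ck_on_const Suc g Ck_on_inverse gp)
        fix p :: 'a assume "p \<in> - {0}"
        then show "g (\<rho> p *\<^sub>R p) \<bullet> p \<noteq> 0" using ray_pos[of "\<rho> p" p] \<rho>[of p] s by auto
      qed
    qed auto
  qed auto
  with \<rho> \<rho>_unique that show ?thesis by blast
qed

section \<open>The bulged cylinder\<close>

text \<open>Since \<open>(s * exp (- 1 / s))'' = exp (- 1 / s) / s ^ 3\<close>, the profile below is convex on the whole
  line and vanishes exactly on \<open>{-1..1}\<close>.\<close>
definition profile :: "real \<Rightarrow> real" where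
  "profile t = (t - 1) * flat 1 (t - 1) + (- t - 1) * flat 1 (- t - 1)"

definition profile' :: "real \<Rightarrow> real" where
  "profile' t = flat [:1, 1:] (t - 1) - flat [:1, 1:] (- t - 1)"

definition profile'' :: "real \<Rightarrow> real" where
  "profile'' t = flat [:0, 0, 0, 1:] (t - 1) + flat [:0, 0, 0, 1:] (- t - 1)"

lemma profile_deriv: "(profile has_real_derivative profile' t) (at t)"
proof -
  have 1: "((\<lambda>s. s * flat 1 s) has_real_derivative flat [:1, 1:] s) (at s)" for s
    using DERIV_mult[OF DERIV_ident flat_has_derivative[of 1 s]]
    by (rule DERIV_cong) (simp add: flat_deriv_1 flat_def algebra_simps)
  have 2: "((\<lambda>t. t - 1) has_real_derivative 1) (at t)" "((\<lambda>t. - t - 1) has_real_derivative - 1) (at t)"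
    by (auto intro!: derivative_eq_intros)
  show ?thesis
    unfolding profile_def[abs_def] profile'_def
    using DERIV_add[OF DERIV_chain2[OF 1 2(1)] DERIV_chain2[OF 1 2(2)]] by simp
qed

lemma profile'_deriv: "(profile' has_real_derivative profile'' t) (at t)"
proof -
  have 1: "(flat [:1, 1:] has_real_derivative flat [:0, 0, 0, 1:] s) (at s)" for s
    using flat_has_derivative[of "[:1, 1:]" s] by (simp add: flat_deriv_def pderiv_pCons)
  have 2: "((\<lambda>t. t - 1) has_real_derivative 1) (at t)" "((\<lambda>t. - t - 1) has_real_derivative - 1) (at t)"
    by (auto intro!: derivative_eq_intros)
  show ?thesis
    unfolding profile'_def[abs_def] profile''_def
    using DERIV_diff[OF DERIV_chain2[OF 1 2(1)] DERIV_chain2[OF 1 2(2)]] by simp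
qed

lemma profile_nonneg: "0 \<le> profile t"
proof -
  have "0 \<le> s * flat 1 s" for s
    by (cases "s \<le> 0") (auto intro!: mult_nonneg_nonneg flat_nonneg)
  then show ?thesis by (simp add: profile_def)
qed

lemma profile_eq_0: "\<bar>t\<bar> \<le> 1 \<Longrightarrow> profile t = 0" "\<bar>t\<bar> \<le> 1 \<Longrightarrow> profile' t = 0"
  "\<bar>t\<bar> \<le> 1 \<Longrightarrow> profile'' t = 0"
  by (auto simp: profile_def profile'_def profile''_def)

lemma profile'_mult_nonneg: "0 \<le> profile' t * t"
proof -
  have f: "0 \<le> flat [:1, 1:] s" for s by (intro flat_nonneg) simp
  consider "\<bar>t\<bar> \<le> 1" | "t > 1" | "t < - 1" by linarith
  then show ?thesis
    by cases (use f in \<open>auto simp: profile_eq_0 profile'_def mult_nonneg_nonpos mult_nonneg_nonneg\<close>)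
qed

lemma profile'_mult_pos: "\<bar>t\<bar> > 1 \<Longrightarrow> 0 < profile' t * t"
proof -
  assume t: "\<bar>t\<bar> > 1"
  have f: "0 < flat [:1, 1:] s" if "s > 0" for s using that by (intro flat_pos) simp_all
  consider "t > 1" | "t < - 1" using t by linarith
  then show ?thesis
    by cases (use f[of "t - 1"] f[of "- t - 1"] in \<open>auto simp: profile'_def mult_pos_neg\<close>)
qed

lemma profile''_nonneg: "0 \<le> profile'' t"
  unfolding profile''_def by (intro add_nonneg_nonneg flat_nonneg) simp_all

lemma profile''_pos: "\<bar>t\<bar> > 1 \<Longrightarrow> 0 < profile'' t"
proof -
  assume t: "\<bar>t\<bar> > 1"
  have f: "0 < flat [:0, 0, 0, 1:] s" if "s > 0" for s using that by (intro flat_pos) simp_all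
  consider "t > 1" | "t < - 1" using t by linarith
  then show ?thesis
    by cases (use f[of "t - 1"] f[of "- t - 1"] in \<open>auto simp: profile''_def\<close>)
qed

text \<open>For s >= 2 one has s exp (- 1 / s) >= 2 (1 - 1 / 2), and s = |t| - 1 is at least 2. This
  confines the level set at height 1 / 2 to the slab |t| <= 3.\<close>

lemma profile_ge_1: "\<bar>t\<bar> \<ge> 3 \<Longrightarrow> 1 \<le> profile t"
proof -
  have f: "1 \<le> s * flat 1 s" if "s \<ge> 2" for s
  proof -
    have "- (1 / 2) \<le> - (1 / s)" using that by (simp add: field_simps)
    then have "1 + - (1 / 2) \<le> exp (- (1 / s))"
      using exp_ge_add_one_self[of "- (1 / s)"] by linarith
    then have "2 * (1 / 2) \<le> s * exp (- (1 / s))"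
      using that by (intro mult_mono) auto
    then show ?thesis using that by (simp add: flat_def)
  qed
  assume "\<bar>t\<bar> \<ge> 3"
  then consider "t \<ge> 3" | "t \<le> - 3" by linarith
  then show ?thesis
    by cases (use f[of "t - 1"] f[of "- t - 1"] in \<open>auto simp: profile_def\<close>)
qed

lemma Ck_on_profile: "Ck_on k U f \<Longrightarrow> Ck_on k U (\<lambda>z. profile (f z))"
proof -
  assume f: "Ck_on k U f"
  have "Ck_on k U (\<lambda>z. (f z + - 1) * flat 1 (f z + - 1) + ((- 1) * f z + - 1) * flat 1 ((- 1) * f z + - 1))"
    by (intro Ck_on_add Ck_on_mult Ck_on_flat f Ck_on_const)
  then show ?thesis by (simp add: profile_def)
qed

text \<open>\<open>d i\<close> stands for the cosine of the i-th radius. B bounds h'' and h'^2 / h,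
  with h' = \<open>flat [:0, 0, 1:]\<close>. The constant is 184 = 2 * 2 * (10 + 36): 10 and 36 come
  from a single summand of the Hessian, one factor 2 is the sum of the weights, the other leaves
  half of |\<eta>|^2.\<close>

locale bulged_cylinder =
  fixes e :: "'a::euclidean_space" and c :: "nat \<Rightarrow> 'a" and d :: "nat \<Rightarrow> real" and \<epsilon> B :: real
  assumes norm_e: "norm e = 1"
    and norm_c: "\<And>i. norm (c i) = 1"
    and c_e: "\<And>i. c i \<bullet> e = 0"
    and d_nonneg: "\<And>i. 0 \<le> d i"
    and \<epsilon>_pos: "0 < \<epsilon>" and B_pos: "0 < B"
    and \<epsilon>_small: "184 * \<epsilon> * B \<le> 1"
    and flat''_le: "\<And>s. \<bar>flat (flat_deriv [:0, 0, 1:]) s\<bar> \<le> B"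
    and flat'_le: "\<And>s. (flat [:0, 0, 1:] s)\<^sup>2 \<le> B * flat 1 s"
begin

lemma e_e: "e \<bullet> e = 1"
  using norm_e by (simp add: dot_square_norm)

section \<open>The series \<psi> and its first two derivatives\<close>

definition \<psi> :: "'a \<Rightarrow> real" where
  "\<psi> = flat_series c d 1 (\<lambda>i. 1)"

definition grad_\<psi> :: "'a \<Rightarrow> 'a" where
  "grad_\<psi> = flat_series c d [:0, 0, 1:] c"

definition hess_\<psi> :: "'a \<Rightarrow> 'a \<Rightarrow> 'a" where
  "hess_\<psi> z v = flat_series c d (flat_deriv [:0, 0, 1:]) (\<lambda>i. (c i \<bullet> v) *\<^sub>R c i) z"

lemma abs_c_inner_le: "\<bar>c i \<bullet> v\<bar> \<le> norm v"
  using Cauchy_Schwarz_ineq2[of "c i" v] norm_c by simp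

lemma grad_\<psi>_inner: "grad_\<psi> z \<bullet> v = flat_series c d [:0, 0, 1:] (\<lambda>i. c i \<bullet> v) z"
  unfolding grad_\<psi>_def by (rule flat_series_inner[where A = 1]) (simp add: norm_c)

lemma hess_\<psi>_inner:
  "hess_\<psi> z v \<bullet> w = flat_series c d (flat_deriv [:0, 0, 1:]) (\<lambda>i. (c i \<bullet> v) * (c i \<bullet> w)) z"
proof -
  have "hess_\<psi> z v \<bullet> w = flat_series c d (flat_deriv [:0, 0, 1:]) (\<lambda>i. ((c i \<bullet> v) *\<^sub>R c i) \<bullet> w) z"
    unfolding hess_\<psi>_def
    by (rule flat_series_inner[where A = "norm v"]) (simp add: norm_c abs_c_inner_le)
  then show ?thesis by simp
qed

lemma \<psi>_deriv: "(\<psi> has_derivative (\<lambda>v. grad_\<psi> z \<bullet> v)) (at z)"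
  using flat_series_has_derivative[of c "\<lambda>i. 1::real" 1 d 1 z]
  by (simp add: \<psi>_def grad_\<psi>_inner norm_c flat_deriv_1)

lemma grad_\<psi>_deriv: "(grad_\<psi> has_derivative hess_\<psi> z) (at z)"
  using flat_series_has_derivative[of c c 1 d "[:0, 0, 1:]" z]
  by (simp add: grad_\<psi>_def hess_\<psi>_def[abs_def] norm_c)

lemma summable_\<psi>: "summable (\<lambda>i. (1 / 2) ^ i * flat 1 (c i \<bullet> z - d i))"
  using summable_flat_series[of "\<lambda>i. 1::real" 1 1 c z d] by simp

lemma \<psi>_nonneg: "0 \<le> \<psi> z"
  unfolding \<psi>_def flat_series_def using summable_\<psi>
  by (intro suminf_nonneg) (auto intro!: mult_nonneg_nonneg flat_nonneg)

lemma \<psi>_eq_0_iff: "\<psi> z = 0 \<longleftrightarrow> (\<forall>i. c i \<bullet> z \<le> d i)"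
proof -
  have "\<psi> z = 0 \<longleftrightarrow> (\<forall>i. (1 / 2) ^ i * flat 1 (c i \<bullet> z - d i) = 0)"
    unfolding \<psi>_def flat_series_def
    using suminf_eq_zero_iff[OF summable_\<psi>[of z]] by (simp add: flat_nonneg)
  also have "\<dots> \<longleftrightarrow> (\<forall>i. c i \<bullet> z \<le> d i)"
    by (auto simp: flat_def not_less)
  finally show ?thesis .
qed

lemma grad_\<psi>_eq_0: "\<psi> z = 0 \<Longrightarrow> grad_\<psi> z = 0"
  by (simp add: \<psi>_eq_0_iff grad_\<psi>_def flat_series_def)

text \<open>A summand is nonzero only where c_i . z > d_i >= 0, and there both h' and c_i . z are
  positive.\<close>

lemma grad_\<psi>_radial: "0 \<le> grad_\<psi> z \<bullet> z"
  unfolding grad_\<psi>_inner flat_series_def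
proof (rule suminf_nonneg)
  show "summable (\<lambda>i. ((1 / 2) ^ i * flat [:0, 0, 1:] (c i \<bullet> z - d i)) *\<^sub>R (c i \<bullet> z))"
    by (rule summable_flat_series[where A = "norm z"]) (simp add: abs_c_inner_le)
  show "0 \<le> ((1 / 2) ^ i * flat [:0, 0, 1:] (c i \<bullet> z - d i)) *\<^sub>R (c i \<bullet> z)" for i
    using d_nonneg[of i]
    by (cases "c i \<bullet> z \<le> d i") (auto intro!: mult_nonneg_nonneg flat_nonneg)
qed

lemma grad_\<psi>_e: "grad_\<psi> z \<bullet> e = 0"
  by (simp add: grad_\<psi>_inner c_e flat_series_def)

lemma hess_\<psi>_e: "hess_\<psi> z v \<bullet> e = 0" "hess_\<psi> z e = 0"
  by (simp add: hess_\<psi>_inner c_e flat_series_def) (simp add: hess_\<psi>_def c_e flat_series_def)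

section \<open>The defining function \<open>G\<close> and its radial behaviour\<close>

definition hsq :: "'a \<Rightarrow> real" where
  "hsq z = z \<bullet> z - (z \<bullet> e)\<^sup>2"

lemma hsq_eq: "hsq z = (norm (z - (z \<bullet> e) *\<^sub>R e))\<^sup>2"
  unfolding power2_norm_eq_inner hsq_def
  by (simp add: inner_diff_left inner_diff_right e_e inner_commute[of e z] power2_eq_square)

lemma hsq_nonneg: "0 \<le> hsq z"
  unfolding hsq_eq by simp

text \<open>\<open>hsq z\<close> is |y|^2. Since \<psi> is constant along e, it is the factor 1 +
  t^2 that bends the perturbation in the direction e: it adds 2 \<epsilon> \<psi> \<tau>^2 to the
  Hessian.\<close>

definition G :: "'a \<Rightarrow> real" where
  "G z = hsq z / 2 + profile (z \<bullet> e) + \<epsilon> * \<psi> z * (1 + (z \<bullet> e)\<^sup>2)"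

definition grad_G :: "'a \<Rightarrow> 'a" where
  "grad_G z = z + (- (z \<bullet> e)) *\<^sub>R e + profile' (z \<bullet> e) *\<^sub>R e
     + (\<epsilon> * (1 + (z \<bullet> e)\<^sup>2)) *\<^sub>R grad_\<psi> z + (2 * \<epsilon> * \<psi> z * (z \<bullet> e)) *\<^sub>R e"

definition hess_G :: "'a \<Rightarrow> 'a \<Rightarrow> 'a" where
  "hess_G z v = v + (- (v \<bullet> e)) *\<^sub>R e + (profile'' (z \<bullet> e) * (v \<bullet> e)) *\<^sub>R e
     + (\<epsilon> * (1 + (z \<bullet> e)\<^sup>2)) *\<^sub>R hess_\<psi> z v + (2 * \<epsilon> * (z \<bullet> e) * (v \<bullet> e)) *\<^sub>R grad_\<psi> z
     + (2 * \<epsilon> * ((grad_\<psi> z \<bullet> v) * (z \<bullet> e) + \<psi> z * (v \<bullet> e))) *\<^sub>R e"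

lemma inner_e_deriv: "((\<lambda>z. z \<bullet> e) has_derivative (\<lambda>v. v \<bullet> e)) (at z)"
  by (auto intro!: derivative_eq_intros)

lemma profile_inner_deriv:
  "((\<lambda>z. profile (z \<bullet> e)) has_derivative (\<lambda>v. profile' (z \<bullet> e) * (v \<bullet> e))) (at z)"
  "((\<lambda>z. profile' (z \<bullet> e)) has_derivative (\<lambda>v. profile'' (z \<bullet> e) * (v \<bullet> e))) (at z)"
  using has_derivative_compose[OF inner_e_deriv profile_deriv[unfolded has_field_derivative_def]]
    has_derivative_compose[OF inner_e_deriv profile'_deriv[unfolded has_field_derivative_def]]
  by auto

lemma hsq_half_deriv: "((\<lambda>z. hsq z / 2) has_derivative (\<lambda>v. z \<bullet> v - (z \<bullet> e) * (v \<bullet> e))) (at z)"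
proof -
  have "((\<lambda>z. (1 / 2) * (z \<bullet> z - (z \<bullet> e) * (z \<bullet> e))) has_derivative
      (\<lambda>v. z \<bullet> v - (z \<bullet> e) * (v \<bullet> e))) (at z)"
    by (auto intro!: derivative_eq_intros simp: fun_eq_iff inner_commute algebra_simps)
  then show ?thesis by (simp add: hsq_def power2_eq_square)
qed

lemma G_deriv: "(G has_derivative (\<lambda>v. grad_G z \<bullet> v)) (at z)"
proof -
  have sq: "((\<lambda>z. 1 + (z \<bullet> e)\<^sup>2) has_derivative (\<lambda>v. 2 * (z \<bullet> e) * (v \<bullet> e))) (at z)"
    by (auto intro!: derivative_eq_intros)
  have "(G has_derivative (\<lambda>v. z \<bullet> v - (z \<bullet> e) * (v \<bullet> e) + profile' (z \<bullet> e) * (v \<bullet> e)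
      + (\<epsilon> * \<psi> z * (2 * (z \<bullet> e) * (v \<bullet> e)) + \<epsilon> * (grad_\<psi> z \<bullet> v) * (1 + (z \<bullet> e)\<^sup>2)))) (at z)"
    unfolding G_def[abs_def]
    by (intro has_derivative_add has_derivative_mult hsq_half_deriv profile_inner_deriv sq
        has_derivative_mult_right \<psi>_deriv)
  moreover have "z \<bullet> v - (z \<bullet> e) * (v \<bullet> e) + profile' (z \<bullet> e) * (v \<bullet> e)
      + (\<epsilon> * \<psi> z * (2 * (z \<bullet> e) * (v \<bullet> e)) + \<epsilon> * (grad_\<psi> z \<bullet> v) * (1 + (z \<bullet> e)\<^sup>2)) = grad_G z \<bullet> v" for v
    by (simp add: grad_G_def inner_add_left inner_diff_left inner_commute[of e v])
  ultimately show ?thesis by simp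
qed

lemma grad_G_deriv: "(grad_G has_derivative hess_G z) (at z)"
  unfolding grad_G_def[abs_def] hess_G_def[abs_def]
  by (rule has_derivative_eq_rhs,
      (rule derivative_intros profile_inner_deriv \<psi>_deriv grad_\<psi>_deriv inner_e_deriv)+)
    (simp add: fun_eq_iff algebra_simps power2_eq_square)

lemma Ck_on_G: "Ck_on k UNIV G"
proof -
  have id: "Ck_on k UNIV (\<lambda>z::'a. z)" by (rule Ck_on_linear[OF bounded_linear_ident])
  have t: "Ck_on k UNIV (\<lambda>z. z \<bullet> e)" by (rule Ck_on_inner_const[OF id])
  have "Ck_on k UNIV (\<lambda>z. (1 / 2) * ((\<Sum>b\<in>Basis. (z \<bullet> b) * (z \<bullet> b)) + (- 1) * ((z \<bullet> e) * (z \<bullet> e)))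
      + profile (z \<bullet> e) + \<epsilon> * \<psi> z * (1 + (z \<bullet> e) * (z \<bullet> e)))"
    unfolding \<psi>_def
    by (intro Ck_on_add Ck_on_mult Ck_on_const Ck_on_sum Ck_on_inner_const id t Ck_on_profile
        Ck_on_flat_series[where A = 1]) (simp_all add: norm_c)
  then show ?thesis
    by (rule Ck_on_cong[OF open_UNIV, rotated])
      (simp add: G_def hsq_def power2_eq_square flip: euclidean_inner)
qed

lemma grad_G_radial: "grad_G z \<bullet> z = hsq z + profile' (z \<bullet> e) * (z \<bullet> e)
    + \<epsilon> * (1 + (z \<bullet> e)\<^sup>2) * (grad_\<psi> z \<bullet> z) + 2 * \<epsilon> * \<psi> z * (z \<bullet> e)\<^sup>2"
  by (simp add: grad_G_def hsq_def inner_add_left inner_diff_left inner_commute[of e z] power2_eq_square)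

lemma grad_G_radial_ge: "hsq z + profile' (z \<bullet> e) * (z \<bullet> e) \<le> grad_G z \<bullet> z"
  unfolding grad_G_radial using \<epsilon>_pos \<psi>_nonneg[of z] grad_\<psi>_radial[of z]
  by (simp add: add_nonneg_nonneg add.assoc)

lemma grad_G_radial_nonneg: "0 \<le> grad_G z \<bullet> z"
  using grad_G_radial_ge[of z] hsq_nonneg[of z] profile'_mult_nonneg[of "z \<bullet> e"] by linarith

text \<open>A vanishing radial derivative forces y = 0 and |t| <= 1, but there every term of G is
  zero, \<psi> included because c_i . z = 0 <= d_i.\<close>

lemma grad_G_radial_pos:
  assumes "0 < G z"
  shows "0 < grad_G z \<bullet> z"
proof (rule ccontr)
  assume "\<not> 0 < grad_G z \<bullet> z"
  then have h: "hsq z = 0" and "profile' (z \<bullet> e) * (z \<bullet> e) = 0"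
    using grad_G_radial_ge[of z] hsq_nonneg[of z] profile'_mult_nonneg[of "z \<bullet> e"] by linarith+
  then have "\<bar>z \<bullet> e\<bar> \<le> 1" using profile'_mult_pos[of "z \<bullet> e"] by force
  moreover have "z = (z \<bullet> e) *\<^sub>R e" using hsq_eq[of z] h by simp
  then have "c i \<bullet> z = 0" for i using c_e by (metis inner_scaleR_right mult_zero_right)
  then have "\<psi> z = 0" using d_nonneg by (simp add: \<psi>_eq_0_iff)
  ultimately show False using assms h by (simp add: G_def profile_eq_0)
qed

lemma G_ge: "hsq z / 2 + profile (z \<bullet> e) \<le> G z"
  unfolding G_def using \<epsilon>_pos \<psi>_nonneg[of z] by simp

lemma height_le:
  assumes "G z = 1 / 2"
  shows "\<bar>z \<bullet> e\<bar> \<le> 3"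
proof (rule ccontr)
  assume "\<not> ?thesis"
  then have "1 \<le> profile (z \<bullet> e)" by (intro profile_ge_1) simp
  then show False using G_ge[of z] hsq_nonneg[of z] assms by linarith
qed

lemma G_ray:
  assumes "p \<noteq> 0"
  shows "\<exists>r>0. G (r *\<^sub>R p) = 1 / 2"
proof -
  have G0: "G 0 = 0"
    using d_nonneg by (simp add: G_def hsq_def profile_eq_0 \<psi>_eq_0_iff)
  have "\<exists>R>0. 1 / 2 \<le> G (R *\<^sub>R p)"
  proof (cases "hsq p = 0")
    case True
    then have nz: "p \<bullet> e \<noteq> 0" using assms by (auto simp: hsq_def)
    \<comment> \<open>At this radius |t| = 3, where the profile is at least 1 and so exceeds the
      level.\<close>
    define R where "R = 3 / \<bar>p \<bullet> e\<bar>"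
    have "\<bar>(R *\<^sub>R p) \<bullet> e\<bar> = 3" using nz by (simp add: R_def abs_mult)
    then have "1 \<le> profile ((R *\<^sub>R p) \<bullet> e)" by (intro profile_ge_1) linarith
    then have "1 / 2 \<le> G (R *\<^sub>R p)"
      using G_ge[of "R *\<^sub>R p"] hsq_nonneg[of "R *\<^sub>R p"] by linarith
    moreover have "R > 0" using nz by (simp add: R_def)
    ultimately show ?thesis by blast
  next
    case False
    then have pos: "0 < hsq p" using hsq_nonneg[of p] by linarith
    \<comment> \<open>At this radius |y| = 1, so |y|^2 / 2 alone reaches the level 1 / 2.\<close>
    define R where "R = 1 / sqrt (hsq p)"
    have "hsq (R *\<^sub>R p) = R\<^sup>2 * hsq p"
      by (simp add: hsq_def power2_eq_square algebra_simps)
    also have "\<dots> = 1" using pos by (simp add: R_def power_divide)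
    finally have "1 / 2 \<le> G (R *\<^sub>R p)"
      using G_ge[of "R *\<^sub>R p"] profile_nonneg[of "(R *\<^sub>R p) \<bullet> e"] by linarith
    moreover have "R > 0" using pos by (simp add: R_def)
    ultimately show ?thesis by blast
  qed
  then obtain R where R: "R > 0" "1 / 2 \<le> G (R *\<^sub>R p)" by blast
  have "continuous_on UNIV G"
    using G_deriv by (meson continuous_at_imp_continuous_on has_derivative_continuous)
  then have "continuous_on {0..R} (\<lambda>r. G (r *\<^sub>R p))"
    by (rule continuous_on_compose2) (auto intro!: continuous_intros)
  then obtain r where r: "0 \<le> r" "G (r *\<^sub>R p) = 1 / 2"
    using IVT'[of "\<lambda>r. G (r *\<^sub>R p)" 0 "1 / 2" R] R G0 by auto
  then have "r \<noteq> 0" using G0 by auto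
  with r show ?thesis by (intro exI[of _ r]) auto
qed

section \<open>Lower bound for the Hessian of \<open>G\<close> and its null directions\<close>

text \<open>One summand of the Hessian of \<psi> (1 + t^2), with k = c_i . v, n = |\<eta>|^2 and s =
  c_i . z - d_i. The h'' term costs at most 10 B n; half of 2 \<tau>^2 h absorbs the mixed term, at
  the cost of 36 B n.\<close>

lemma hess_term_ge:
  assumes "\<bar>t\<bar> \<le> 3" "k\<^sup>2 \<le> n"
  shows "flat 1 s * \<tau>\<^sup>2 - 46 * B * n \<le>
    (1 + t\<^sup>2) * (flat (flat_deriv [:0, 0, 1:]) s * (k * k)) + 4 * t * \<tau> * (flat [:0, 0, 1:] s * k)
    + 2 * \<tau>\<^sup>2 * flat 1 s"
proof -
  let ?h1 = "flat [:0, 0, 1:] s" and ?h2 = "flat (flat_deriv [:0, 0, 1:]) s" and ?h = "flat 1 s"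
  have t2: "t\<^sup>2 \<le> 9" using assms(1) abs_le_square_iff[of t 3] by simp
  have "\<bar>(1 + t\<^sup>2) * (?h2 * (k * k))\<bar> \<le> 10 * (B * n)"
    using t2 flat''_le[of s] B_pos assms(2) unfolding abs_mult power2_eq_square[symmetric]
    by (intro mult_mono) (auto simp: abs_mult[symmetric] power2_eq_square)
  then have 1: "- (10 * (B * n)) \<le> (1 + t\<^sup>2) * (?h2 * (k * k))" by linarith
  \<comment> \<open>Completing the square with weight B: together with h'^2 <= B h the expansion
    bounds B times the mixed term from below, and B is then cancelled.\<close>
  have "0 \<le> (\<tau> * ?h1 + 2 * t * B * k)\<^sup>2" by simp
  then have "- (\<tau>\<^sup>2 * ?h1\<^sup>2) - 4 * (t\<^sup>2 * B\<^sup>2 * k\<^sup>2) \<le> B * (4 * t * \<tau> * (?h1 * k))"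
    by (simp add: power2_eq_square algebra_simps)
  moreover have "\<tau>\<^sup>2 * ?h1\<^sup>2 \<le> \<tau>\<^sup>2 * (B * ?h)"
    using flat'_le[of s] by (intro mult_left_mono) auto
  moreover have "t\<^sup>2 * B\<^sup>2 * k\<^sup>2 \<le> 9 * B\<^sup>2 * n"
    using t2 assms(2) B_pos by (intro mult_mono) auto
  ultimately have "- (\<tau>\<^sup>2 * (B * ?h)) - 36 * (B\<^sup>2 * n) \<le> B * (4 * t * \<tau> * (?h1 * k))" by linarith
  then have "B * (- (\<tau>\<^sup>2 * ?h) - 36 * (B * n)) \<le> B * (4 * t * \<tau> * (?h1 * k))"
    by (simp add: algebra_simps power2_eq_square)
  then have 2: "- (\<tau>\<^sup>2 * ?h) - 36 * (B * n) \<le> 4 * t * \<tau> * (?h1 * k)"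
    using B_pos by (simp only: mult_le_cancel_left_pos)
  have "?h * \<tau>\<^sup>2 - 46 * B * n = - (10 * (B * n)) + (- (\<tau>\<^sup>2 * ?h) - 36 * (B * n)) + 2 * \<tau>\<^sup>2 * ?h"
    by (simp add: algebra_simps)
  then show ?thesis using 1 2 by linarith
qed

text \<open>The bound for one summand is added up against the weights 2^(-i), whose total 2 turns 46
  into 92.\<close>

lemma hess_\<psi>_combination_ge:
  assumes "\<bar>t\<bar> \<le> 3"
  shows "\<psi> z * (v \<bullet> e)\<^sup>2 - 92 * B * hsq v \<le>
    (1 + t\<^sup>2) * (hess_\<psi> z v \<bullet> v) + 4 * t * (v \<bullet> e) * (grad_\<psi> z \<bullet> v) + 2 * (v \<bullet> e)\<^sup>2 * \<psi> z"
proof -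
  let ?n = "hsq v"
  let ?w = "\<lambda>i. (1 / 2) ^ i :: real" and ?s = "\<lambda>i. c i \<bullet> z - d i"
  have \<psi>: "(\<lambda>i. ?w i * flat 1 (?s i)) sums \<psi> z"
    using summable_sums[OF summable_\<psi>[of z]] by (simp add: \<psi>_def flat_series_def)
  have grad: "(\<lambda>i. ?w i * flat [:0, 0, 1:] (?s i) * (c i \<bullet> v)) sums (grad_\<psi> z \<bullet> v)"
    using summable_sums[OF summable_flat_series[of "\<lambda>i. c i \<bullet> v" "norm v" "[:0, 0, 1:]" c z d]]
    by (simp add: grad_\<psi>_inner flat_series_def abs_c_inner_le)
  have "norm ((c i \<bullet> v) * (c i \<bullet> v)) \<le> norm v * norm v" for i
    unfolding real_norm_def abs_mult using abs_c_inner_le[of i v] by (intro mult_mono) auto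
  from summable_sums[OF summable_flat_series[OF this, of "flat_deriv [:0, 0, 1:]" c z d]]
  have hess: "(\<lambda>i. ?w i * flat (flat_deriv [:0, 0, 1:]) (?s i) * ((c i \<bullet> v) * (c i \<bullet> v))) sums (hess_\<psi> z v \<bullet> v)"
    by (simp add: hess_\<psi>_inner flat_series_def)
  \<comment> \<open>Only the horizontal part of v counts, since c_i is orthogonal to e.\<close>
  have cv: "(c i \<bullet> v)\<^sup>2 \<le> ?n" for i
  proof -
    have "c i \<bullet> v = c i \<bullet> (v - (v \<bullet> e) *\<^sub>R e)" by (simp add: inner_diff_right c_e)
    then have "\<bar>c i \<bullet> v\<bar> \<le> norm (v - (v \<bullet> e) *\<^sub>R e)" using abs_c_inner_le by metis
    then show ?thesis unfolding hsq_eq using abs_le_square_iff by force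
  qed
  have "(\<lambda>i. ?w i) sums 2"
    using geometric_sums[of "1 / 2 :: real"] by simp
  then have l: "(\<lambda>i. ?w i * flat 1 (?s i) * (v \<bullet> e)\<^sup>2 - 46 * B * ?n * ?w i) sums
      (\<psi> z * (v \<bullet> e)\<^sup>2 - 46 * B * ?n * 2)"
    by (intro sums_diff sums_mult sums_mult2 \<psi>)
  have r: "(\<lambda>i. (1 + t\<^sup>2) * (?w i * flat (flat_deriv [:0, 0, 1:]) (?s i) * ((c i \<bullet> v) * (c i \<bullet> v)))
      + 4 * t * (v \<bullet> e) * (?w i * flat [:0, 0, 1:] (?s i) * (c i \<bullet> v))
      + 2 * (v \<bullet> e)\<^sup>2 * (?w i * flat 1 (?s i))) sums
    ((1 + t\<^sup>2) * (hess_\<psi> z v \<bullet> v) + 4 * t * (v \<bullet> e) * (grad_\<psi> z \<bullet> v) + 2 * (v \<bullet> e)\<^sup>2 * \<psi> z)"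
    by (intro sums_add sums_mult \<psi> grad hess)
  have "\<psi> z * (v \<bullet> e)\<^sup>2 - 46 * B * ?n * 2 \<le>
    (1 + t\<^sup>2) * (hess_\<psi> z v \<bullet> v) + 4 * t * (v \<bullet> e) * (grad_\<psi> z \<bullet> v) + 2 * (v \<bullet> e)\<^sup>2 * \<psi> z"
  proof (rule sums_le[OF _ l r])
    fix i
    have "?w i * (flat 1 (?s i) * (v \<bullet> e)\<^sup>2 - 46 * B * ?n) \<le> ?w i *
      ((1 + t\<^sup>2) * (flat (flat_deriv [:0, 0, 1:]) (?s i) * ((c i \<bullet> v) * (c i \<bullet> v)))
        + 4 * t * (v \<bullet> e) * (flat [:0, 0, 1:] (?s i) * (c i \<bullet> v)) + 2 * (v \<bullet> e)\<^sup>2 * flat 1 (?s i))"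
      by (rule mult_left_mono[OF hess_term_ge[OF assms cv]]) simp
    then show "?w i * flat 1 (?s i) * (v \<bullet> e)\<^sup>2 - 46 * B * ?n * ?w i \<le>
      (1 + t\<^sup>2) * (?w i * flat (flat_deriv [:0, 0, 1:]) (?s i) * ((c i \<bullet> v) * (c i \<bullet> v)))
      + 4 * t * (v \<bullet> e) * (?w i * flat [:0, 0, 1:] (?s i) * (c i \<bullet> v))
      + 2 * (v \<bullet> e)\<^sup>2 * (?w i * flat 1 (?s i))"
      by (simp only: distrib_left right_diff_distrib mult_ac)
  qed
  then show ?thesis by simp
qed

text \<open>The term |y|^2 / 2 contributes |\<eta>|^2, and the loss 92 \<epsilon> B |\<eta>|^2 uses
  up at most half of it.\<close>

lemma hess_G_ge:
  assumes "\<bar>z \<bullet> e\<bar> \<le> 3"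
  shows "hsq v / 2 + (profile'' (z \<bullet> e) + \<epsilon> * \<psi> z) * (v \<bullet> e)\<^sup>2 \<le> hess_G z v \<bullet> v"
proof -
  let ?n = "hsq v" and ?t = "z \<bullet> e" and ?\<tau> = "v \<bullet> e"
  have eq: "hess_G z v \<bullet> v = ?n + profile'' ?t * ?\<tau>\<^sup>2
    + \<epsilon> * ((1 + ?t\<^sup>2) * (hess_\<psi> z v \<bullet> v) + 4 * ?t * ?\<tau> * (grad_\<psi> z \<bullet> v) + 2 * ?\<tau>\<^sup>2 * \<psi> z)"
    by (simp add: hess_G_def hsq_def inner_add_left inner_diff_left inner_commute[of e v] power2_eq_square algebra_simps)
  have "\<epsilon> * (\<psi> z * ?\<tau>\<^sup>2 - 92 * B * ?n) \<le>
      \<epsilon> * ((1 + ?t\<^sup>2) * (hess_\<psi> z v \<bullet> v) + 4 * ?t * ?\<tau> * (grad_\<psi> z \<bullet> v) + 2 * ?\<tau>\<^sup>2 * \<psi> z)"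
    using hess_\<psi>_combination_ge[OF assms] \<epsilon>_pos by (intro mult_left_mono) auto
  moreover have "184 * \<epsilon> * B * ?n \<le> 1 * ?n"
    using \<epsilon>_small hsq_nonneg by (intro mult_right_mono) auto
  moreover have "\<epsilon> * (\<psi> z * ?\<tau>\<^sup>2 - 92 * B * ?n) = \<epsilon> * \<psi> z * ?\<tau>\<^sup>2 - 184 * \<epsilon> * B * ?n / 2"
    by (simp add: algebra_simps)
  moreover have "(profile'' ?t + \<epsilon> * \<psi> z) * ?\<tau>\<^sup>2 = profile'' ?t * ?\<tau>\<^sup>2 + \<epsilon> * \<psi> z * ?\<tau>\<^sup>2"
    by (simp add: algebra_simps)
  ultimately show ?thesis
    unfolding eq by linarith
qed

lemma hess_G_nonneg:
  assumes "\<bar>z \<bullet> e\<bar> \<le> 3"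
  shows "0 \<le> hess_G z v \<bullet> v"
  using hess_G_ge[OF assms, of v] hsq_nonneg[of v] profile''_nonneg[of "z \<bullet> e"] \<psi>_nonneg[of z] \<epsilon>_pos
  by (smt (verit) divide_nonneg_nonneg mult_nonneg_nonneg zero_le_power2)

text \<open>Both nonnegative terms of the Hessian bound have to vanish. The first leaves v parallel
  to e, the second then annihilates the coefficient of \<tau>^2.\<close>

lemma hess_G_eq_0D:
  assumes "\<bar>z \<bullet> e\<bar> \<le> 3" "hess_G z v \<bullet> v = 0" "v \<noteq> 0"
  shows "v \<bullet> e \<noteq> 0" "\<psi> z = 0" "\<bar>z \<bullet> e\<bar> \<le> 1"
proof -
  have nn: "0 \<le> profile'' (z \<bullet> e)" "0 \<le> \<epsilon> * \<psi> z"
    using profile''_nonneg \<psi>_nonneg \<epsilon>_pos by auto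
  then have "0 \<le> (profile'' (z \<bullet> e) + \<epsilon> * \<psi> z) * (v \<bullet> e)\<^sup>2" by simp
  then have n: "hsq v = 0" and p: "(profile'' (z \<bullet> e) + \<epsilon> * \<psi> z) * (v \<bullet> e)\<^sup>2 = 0"
    using hess_G_ge[OF assms(1), of v, unfolded assms(2)] hsq_nonneg[of v] by linarith+
  show \<tau>: "v \<bullet> e \<noteq> 0" using n assms(3) by (auto simp: hsq_def)
  with p have "profile'' (z \<bullet> e) + \<epsilon> * \<psi> z = 0" by simp
  with nn have "profile'' (z \<bullet> e) = 0" "\<epsilon> * \<psi> z = 0" by linarith+
  then show "\<psi> z = 0" "\<bar>z \<bullet> e\<bar> \<le> 1"
    using \<epsilon>_pos profile''_pos[of "z \<bullet> e"] by force+
qed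

text \<open>At these points the profile is zero to second order, \<psi> and its gradient vanish, and
  the Hessian of \<psi> does not see e. To second order the level set is a cylinder with ruling
  e.\<close>

lemma flat_direction:
  assumes "\<psi> z = 0" "\<bar>z \<bullet> e\<bar> \<le> 1"
  shows "grad_G z \<bullet> e = 0" "hess_G z e = 0" "hess_G z v \<bullet> e = 0"
  using assms
  by (simp_all add: grad_G_def hess_G_def inner_add_left e_e grad_\<psi>_e hess_\<psi>_e grad_\<psi>_eq_0 profile_eq_0
      inner_diff_left)

section \<open>Gauss map and Weingarten map of the level set\<close>

definition normal :: "'a \<Rightarrow> 'a" where
  "normal z = sgn (grad_G z)"

text \<open>The derivative of the normalised gradient, that is dN itself without the customary minus
  sign, so that convexity appears as positive semidefiniteness.\<close>

definition weingarten :: "'a \<Rightarrow> 'a \<Rightarrow> 'a" where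
  "weingarten z v = (1 / norm (grad_G z)) *\<^sub>R (hess_G z v - (hess_G z v \<bullet> normal z) *\<^sub>R normal z)"

lemma grad_G_nz: "G z = 1 / 2 \<Longrightarrow> grad_G z \<noteq> 0"
  using grad_G_radial_pos[of z] by auto

lemma norm_normal: "G z = 1 / 2 \<Longrightarrow> norm (normal z) = 1"
  using grad_G_nz[of z] by (simp add: normal_def norm_sgn)

lemma inner_normal_eq_0_iff: "G z = 1 / 2 \<Longrightarrow> v \<bullet> normal z = 0 \<longleftrightarrow> grad_G z \<bullet> v = 0"
  using grad_G_nz[of z] by (simp add: normal_def sgn_div_norm inner_commute)

lemma normal_deriv: "G z = 1 / 2 \<Longrightarrow> (normal has_derivative weingarten z) (at z)"
  unfolding normal_def[abs_def] weingarten_def[abs_def]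
  by (rule has_derivative_sgn[OF grad_G_deriv grad_G_nz])

lemma weingarten_normal: "G z = 1 / 2 \<Longrightarrow> weingarten z v \<bullet> normal z = 0"
  using norm_normal[of z] by (simp add: weingarten_def inner_diff_left dot_square_norm)

lemma weingarten_inner:
  "w \<bullet> normal z = 0 \<Longrightarrow> weingarten z v \<bullet> w = (hess_G z v \<bullet> w) / norm (grad_G z)"
  by (simp add: weingarten_def inner_diff_left inner_commute[of "normal z"])

lemma weingarten_nonneg: "G z = 1 / 2 \<Longrightarrow> v \<bullet> normal z = 0 \<Longrightarrow> 0 \<le> weingarten z v \<bullet> v"
  by (simp add: weingarten_inner hess_G_nonneg height_le)

lemma weingarten_eq_0D:
  assumes "G z = 1 / 2" "v \<bullet> normal z = 0" "weingarten z v = 0" "v \<noteq> 0"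
  shows "v \<bullet> e \<noteq> 0" "\<psi> z = 0" "\<bar>z \<bullet> e\<bar> \<le> 1"
proof -
  have "hess_G z v \<bullet> v = 0"
    using weingarten_inner[OF assms(2), of v] assms(3) grad_G_nz[OF assms(1)] by simp
  from hess_G_eq_0D[OF height_le[OF assms(1)] this assms(4)]
  show "v \<bullet> e \<noteq> 0" "\<psi> z = 0" "\<bar>z \<bullet> e\<bar> \<le> 1" by auto
qed

lemma weingarten_flat_direction:
  assumes "G z = 1 / 2" "\<psi> z = 0" "\<bar>z \<bullet> e\<bar> \<le> 1"
  shows "e \<bullet> normal z = 0" "weingarten z e = 0" "weingarten z v \<bullet> e = 0"
proof -
  show *: "e \<bullet> normal z = 0"
    using flat_direction[OF assms(2,3)] inner_normal_eq_0_iff[OF assms(1)] by simp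
  show "weingarten z e = 0" "weingarten z v \<bullet> e = 0"
    using flat_direction[OF assms(2,3)] by (simp_all add: weingarten_inner[OF *]) (simp add: weingarten_def)
qed

text \<open>Where \<psi> and the profile vanish, the level set is the cylinder |y| = 1, so p = y + t
  e has radius \<rho> = 1 / |y|. Then |\<rho> t| <= 1 means t^2 <= 1 - t^2, whence 1 / sqrt 2. The
  point \<rho> y is the normalised projection of p to the equator, and \<psi> agrees there with its
  value at \<rho> p.\<close>

lemma flat_point_iff_band:
  fixes F :: "'a set"
  assumes F: "\<And>q. norm q = 1 \<Longrightarrow> q \<bullet> e = 0 \<Longrightarrow> q \<in> F \<longleftrightarrow> (\<forall>i. c i \<bullet> q \<le> d i)"
    and p: "norm p = 1"
    and \<rho>: "0 < \<rho>" "G (\<rho> *\<^sub>R p) = 1 / 2"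
    and unique: "\<And>r. 0 < r \<Longrightarrow> G (r *\<^sub>R p) = 1 / 2 \<Longrightarrow> \<rho> = r"
  shows "(\<psi> (\<rho> *\<^sub>R p) = 0 \<and> \<bar>(\<rho> *\<^sub>R p) \<bullet> e\<bar> \<le> 1) \<longleftrightarrow>
    (\<bar>p \<bullet> e\<bar> \<le> 1 / sqrt 2 \<and> (1 / norm (p - (p \<bullet> e) *\<^sub>R e)) *\<^sub>R (p - (p \<bullet> e) *\<^sub>R e) \<in> F)"
proof -
  define t y where "t = p \<bullet> e" and "y = p - t *\<^sub>R e"
  have hs: "hsq p = 1 - t\<^sup>2" and ny: "(norm y)\<^sup>2 = 1 - t\<^sup>2"
    using hsq_eq[of p] p by (simp_all add: hsq_def t_def y_def dot_square_norm)
  have hr: "hsq (r *\<^sub>R p) = r\<^sup>2 * (1 - t\<^sup>2)" for r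
    unfolding hs[symmetric] hsq_def by (simp add: power2_eq_square algebra_simps)
  have ye: "y \<bullet> e = 0" by (simp add: y_def t_def inner_diff_left e_e)
  have cy: "c i \<bullet> (r *\<^sub>R y) = c i \<bullet> (r *\<^sub>R p)" for i r
    by (simp add: y_def inner_diff_right c_e)
  have root: "\<bar>t\<bar> \<le> 1 / sqrt 2 \<longleftrightarrow> t\<^sup>2 \<le> 1 / 2"
    using abs_le_square_iff[of t "1 / sqrt 2"] by (simp add: power_divide)
  have sq1: "\<bar>s\<bar> \<le> 1 \<longleftrightarrow> s\<^sup>2 \<le> 1" for s :: real
    using abs_le_square_iff[of s 1] by simp
  have ht: "((r *\<^sub>R p) \<bullet> e)\<^sup>2 = r\<^sup>2 * t\<^sup>2" for r
    by (simp add: t_def power_mult_distrib)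
  have "(\<psi> (\<rho> *\<^sub>R p) = 0 \<and> \<bar>(\<rho> *\<^sub>R p) \<bullet> e\<bar> \<le> 1) \<longleftrightarrow> (\<bar>t\<bar> \<le> 1 / sqrt 2 \<and> (1 / norm y) *\<^sub>R y \<in> F)"
  proof
    assume asm: "\<psi> (\<rho> *\<^sub>R p) = 0 \<and> \<bar>(\<rho> *\<^sub>R p) \<bullet> e\<bar> \<le> 1"
    then have one: "\<rho>\<^sup>2 * (1 - t\<^sup>2) = 1"
      using \<rho>(2) hr[of \<rho>] by (simp add: G_def profile_eq_0)
    then have "(\<rho> * norm y)\<^sup>2 = 1" by (simp add: power_mult_distrib ny)
    then have "\<rho> * norm y = 1" using \<rho>(1) by (simp add: power2_eq_1_iff) (smt (verit) mult_nonneg_nonneg norm_ge_zero)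
    then have r: "1 / norm y = \<rho>" and q: "norm (\<rho> *\<^sub>R y) = 1"
      using \<rho>(1) by (auto simp: nonzero_eq_divide_eq divide_eq_eq)
    have "\<rho> *\<^sub>R y \<in> F"
      using F[OF q] asm ye unfolding cy \<psi>_eq_0_iff by simp
    moreover have "\<rho>\<^sup>2 * t\<^sup>2 \<le> \<rho>\<^sup>2 * (1 - t\<^sup>2)" using asm unfolding sq1 ht one by simp
    then have "t\<^sup>2 \<le> 1 / 2" using \<rho>(1) by simp
    ultimately show "\<bar>t\<bar> \<le> 1 / sqrt 2 \<and> (1 / norm y) *\<^sub>R y \<in> F" by (simp add: r root)
  next
    assume asm: "\<bar>t\<bar> \<le> 1 / sqrt 2 \<and> (1 / norm y) *\<^sub>R y \<in> F"
    then have t: "t\<^sup>2 \<le> 1 / 2" by (simp add: root)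
    then have "norm y \<noteq> 0" using ny by auto
    \<comment> \<open>The radius at which the ray meets the cylinder; uniqueness identifies it with
      \<rho> in the end.\<close>
    define r where "r = 1 / norm y"
    have r: "0 < r" "norm (r *\<^sub>R y) = 1" using \<open>norm y \<noteq> 0\<close> by (auto simp: r_def)
    have one: "r\<^sup>2 * (1 - t\<^sup>2) = 1"
      unfolding ny[symmetric] r_def using \<open>norm y \<noteq> 0\<close> by (simp add: power_divide)
    have 0: "\<psi> (r *\<^sub>R p) = 0"
      using F[OF r(2)] asm ye unfolding r_def[symmetric] cy \<psi>_eq_0_iff by simp
    have "r\<^sup>2 * t\<^sup>2 \<le> r\<^sup>2 * (1 - t\<^sup>2)" using t by (intro mult_left_mono) auto
    then have le: "\<bar>(r *\<^sub>R p) \<bullet> e\<bar> \<le> 1" unfolding sq1 ht one .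
    have "G (r *\<^sub>R p) = 1 / 2"
      unfolding G_def hr one 0 profile_eq_0(1)[OF le] by simp
    from unique[OF r(1) this] 0 le
    show "\<psi> (\<rho> *\<^sub>R p) = 0 \<and> \<bar>(\<rho> *\<^sub>R p) \<bullet> e\<bar> \<le> 1" by simp
  qed
  then show ?thesis by (simp only: t_def y_def)
qed

end

section \<open>The radial parametrisation as an immersion of the sphere\<close>

text \<open>For x p = \<rho> p p one has dN = \<open>weingarten\<close> o dx, so curvature and rank
  become the determinant and rank of \<open>weingarten\<close> on the tangent hyperplane. Any point
  of F supplies a point where the rank drops.\<close>

lemma bulged_cylinder_immersion:
  fixes e :: "real^'n" and F :: "(real^'n) set"
  assumes cyl: "bulged_cylinder e c d \<epsilon> B"
    and F: "\<And>q. norm q = 1 \<Longrightarrow> q \<bullet> e = 0 \<Longrightarrow> q \<in> F \<longleftrightarrow> (\<forall>i. c i \<bullet> q \<le> d i)"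
    and Fe: "F \<subseteq> equator e" "F \<noteq> {}"
  shows "\<exists>(x :: real^'n \<Rightarrow> real^'n) N N' U c.
       0 < c \<and> c < 1 \<and> sphere 0 1 \<subseteq> U \<and> smooth_on U x \<and>
       (\<forall>p \<in> sphere 0 1. inj_on (frechet_derivative x (at p)) (tang p)) \<and>
       gauss_map x N \<and>
       (\<forall>p \<in> sphere 0 1. (N has_derivative N' p) (at p within sphere 0 1)) \<and>
       (\<forall>p \<in> sphere 0 1. CARD('n) - 2 \<le> shape_rank N' p) \<and>
       (\<exists>p \<in> sphere 0 1. shape_rank N' p = CARD('n) - 2) \<and>
       (\<forall>p \<in> sphere 0 1. 0 \<le> GK_curv x N N' p) \<and>
       {p \<in> sphere 0 1. GK_curv x N N' p = 0} = band_set e c F"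
proof -
  interpret bulged_cylinder e c d \<epsilon> B by (rule cyl)
  obtain \<rho> where \<rho>: "\<And>p. p \<noteq> 0 \<Longrightarrow> 0 < \<rho> p" "\<And>p. p \<noteq> 0 \<Longrightarrow> G (\<rho> p *\<^sub>R p) = 1 / 2"
    "\<And>p r. 0 < r \<Longrightarrow> G (r *\<^sub>R p) = 1 / 2 \<Longrightarrow> \<rho> p = r" "\<And>k. Ck_on k (- {0}) \<rho>"
    by (rule star_shaped_level_set[OF Ck_on_G G_deriv grad_G_radial_nonneg grad_G_radial_pos _ G_ray]) auto
  define x where "x p = \<rho> p *\<^sub>R p" for p
  obtain \<rho>' where \<rho>': "\<And>p. p \<noteq> 0 \<Longrightarrow> (\<rho> has_derivative \<rho>' p) (at p)"
    using \<rho>(4)[of "Suc 0"] by auto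
  define X' where "X' p v = \<rho> p *\<^sub>R v + \<rho>' p v *\<^sub>R p" for p v
  have x': "(x has_derivative X' p) (at p)" if "p \<noteq> 0" for p
    unfolding x_def[abs_def] X'_def[abs_def] using has_derivative_scaleR[OF \<rho>'[OF that] has_derivative_ident] .
  have fx: "frechet_derivative x (at p) = X' p" if "p \<noteq> 0" for p
    using frechet_derivative_at[OF x'[OF that]] by simp
  have Gx: "G (x p) = 1 / 2" if "p \<noteq> 0" for p
    using \<rho>(2)[OF that] by (simp add: x_def)
  have tan: "X' p v \<bullet> normal (x p) = 0" if p: "p \<noteq> 0" for p v
  proof -
    \<comment> \<open>G o x is constant, so its derivative by the chain rule is zero.\<close>
    have "((\<lambda>q. G (x q)) has_derivative (\<lambda>v. grad_G (x p) \<bullet> X' p v)) (at p)"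
      by (rule has_derivative_compose[OF x'[OF p] G_deriv])
    moreover have "((\<lambda>q. G (x q)) has_derivative (\<lambda>v. 0)) (at p)"
    proof (rule has_derivative_transform_within_open[where f = "\<lambda>q. 1 / 2" and s = "- {0}"])
      show "1 / 2 = G (x q)" if "q \<in> - {0}" for q using Gx[of q] that by simp
    qed (use p in auto)
    ultimately have "grad_G (x p) \<bullet> X' p v = 0"
      using has_derivative_unique by metis
    then show ?thesis using inner_normal_eq_0_iff[OF Gx[OF p]] by simp
  qed
  have inj: "v = 0" if "norm p = 1" "v \<in> tang p" "X' p v = 0" for p v
  proof -
    \<comment> \<open>For tangent v the component of the image along p is \<rho>' p v. A kernel
      vector therefore has \<rho>' p v = 0, which leaves only the multiple \<rho> p of v.\<close>
    have "X' p v \<bullet> p = \<rho>' p v"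
      using that(1,2) by (simp add: X'_def inner_add_left tang_def dot_square_norm)
    then have "\<rho> p *\<^sub>R v = 0" using that(3) by (simp add: X'_def)
    moreover have "p \<noteq> 0" using that(1) by auto
    ultimately show ?thesis using \<rho>(1)[of p] by simp
  qed
  define N where "N p = normal (x p)" for p
  define N' where "N' p v = weingarten (x p) (X' p v)" for p v
  have N': "(N has_derivative N' p) (at p)" if "p \<noteq> 0" for p
    unfolding N_def[abs_def] N'_def[abs_def]
    by (rule has_derivative_compose[OF x'[OF that] normal_deriv[OF Gx[OF that]]])
  have lin: "linear (X' p)" "linear (weingarten (x p))" if "p \<noteq> 0" for p
    using has_derivative_linear x'[OF that] normal_deriv[OF Gx[OF that]] by blast+
  have band: "(\<psi> (x p) = 0 \<and> \<bar>x p \<bullet> e\<bar> \<le> 1) \<longleftrightarrow> p \<in> band_set e (1 / sqrt 2) F" if p: "norm p = 1" for p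
  proof -
    have "p \<noteq> 0" using p by auto
    then show ?thesis
      using flat_point_iff_band[OF F p \<rho>(1,2,3)] p by (simp add: x_def band_set_def)
  qed
  have GK: "GK_curv x N N' p = det (matrix (ext_map (normal (x p)) (weingarten (x p)) (normal (x p))))"
    if p: "norm p = 1" for p
  proof -
    have nz: "p \<noteq> 0" using p by auto
    show ?thesis
      unfolding GK_curv_def N_def N'_def[abs_def] fx[OF nz]
      by (rule det_ext_map_quotient[OF lin[OF nz] p norm_normal[OF Gx[OF nz]] inj[OF p] tan[OF nz]])
  qed
  have det: "0 \<le> GK_curv x N N' p" "GK_curv x N N' p = 0 \<longleftrightarrow> p \<in> band_set e (1 / sqrt 2) F"
    if p: "norm p = 1" for p
  proof -
    have nz: "p \<noteq> 0" using p by auto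
    note D = det_ext_map_normal[OF lin(2)[OF nz] norm_normal[OF Gx[OF nz]] weingarten_normal[OF Gx[OF nz]]
        weingarten_nonneg[OF Gx[OF nz]]]
    show "0 \<le> GK_curv x N N' p"
      unfolding GK[OF p] by (rule D(1)) (auto simp: tang_def)
    have "GK_curv x N N' p = 0 \<longleftrightarrow> (\<exists>v\<in>tang (normal (x p)). v \<noteq> 0 \<and> weingarten (x p) v = 0)"
      unfolding GK[OF p] by (rule D(2)) (auto simp: tang_def)
    also have "\<dots> \<longleftrightarrow> (\<psi> (x p) = 0 \<and> \<bar>x p \<bullet> e\<bar> \<le> 1)"
    proof
      assume "\<exists>v\<in>tang (normal (x p)). v \<noteq> 0 \<and> weingarten (x p) v = 0"
      then show "\<psi> (x p) = 0 \<and> \<bar>x p \<bullet> e\<bar> \<le> 1"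
        using weingarten_eq_0D[OF Gx[OF nz]] by (auto simp: tang_def)
    next
      assume "\<psi> (x p) = 0 \<and> \<bar>x p \<bullet> e\<bar> \<le> 1"
      then have "e \<in> tang (normal (x p))" "weingarten (x p) e = 0"
        using weingarten_flat_direction[OF Gx[OF nz]] by (auto simp: tang_def)
      moreover have "e \<noteq> 0" using norm_e by auto
      ultimately show "\<exists>v\<in>tang (normal (x p)). v \<noteq> 0 \<and> weingarten (x p) v = 0" by blast
    qed
    finally show "GK_curv x N N' p = 0 \<longleftrightarrow> p \<in> band_set e (1 / sqrt 2) F"
      unfolding band[OF p] .
  qed
  have rank: "shape_rank N' p = dim (weingarten (x p) ` tang (normal (x p)))" if p: "norm p = 1" for p
  proof -
    have nz: "p \<noteq> 0" using p by auto
    have "X' p ` tang p = tang (normal (x p))"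
      by (rule image_tang_eq[OF lin(1)[OF nz] p norm_normal[OF Gx[OF nz]] inj[OF p] tan[OF nz]])
    moreover have "N' p ` tang p = weingarten (x p) ` X' p ` tang p"
      by (simp add: N'_def[abs_def] image_image)
    ultimately show ?thesis by (simp add: shape_rank_def)
  qed
  have rank_ge: "CARD('n) - 2 \<le> shape_rank N' p" if p: "norm p = 1" for p
  proof -
    have nz: "p \<noteq> 0" using p by auto
    show ?thesis
      unfolding rank[OF p]
      by (rule dim_image_tang_ge[OF lin(2)[OF nz], of _ e]) (use weingarten_eq_0D(1)[OF Gx[OF nz]] in blast)
  qed
  have rank_ex: "\<exists>p \<in> sphere 0 1. shape_rank N' p = CARD('n) - 2"
  proof -
    obtain q where q: "q \<in> F" using Fe(2) by blast
    then have nq: "norm q = 1" "q \<bullet> e = 0" using Fe(1) by (auto simp: equator_def)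
    then have nz: "q \<noteq> 0" by auto
    \<comment> \<open>On the equator t = 0, so q is its own normalised projection and lies in the
      middle of the band.\<close>
    have "q \<in> band_set e (1 / sqrt 2) F" using q nq by (simp add: band_set_def)
    then have flat: "\<psi> (x q) = 0" "\<bar>x q \<bullet> e\<bar> \<le> 1" using band[OF nq(1)] by auto
    have "dim (weingarten (x q) ` tang (normal (x q))) \<le> CARD('n) - 2"
    proof (rule dim_image_tang_le[OF norm_normal[OF Gx[OF nz]] norm_e])
      show "normal (x q) \<bullet> e = 0"
        using weingarten_flat_direction(1)[OF Gx[OF nz] flat] by (simp add: inner_commute)
    qed (use weingarten_normal[OF Gx[OF nz]] weingarten_flat_direction(3)[OF Gx[OF nz] flat] in auto)
    then have "shape_rank N' q = CARD('n) - 2"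
      using rank[OF nq(1)] rank_ge[OF nq(1)] by simp
    then show ?thesis using nq(1) by auto
  qed
  have nz: "p \<noteq> 0" if "p \<in> sphere 0 1" for p :: "real^'n"
    using that by auto
  have smooth: "smooth_on (- {0}) x"
  proof (rule smooth_on_if_Ck_on)
    show "Ck_on k (- {0}) x" for k
      unfolding x_def[abs_def] by (intro Ck_on_scaleR \<rho>(4) Ck_on_linear bounded_linear_ident)
  qed auto
  have gauss: "gauss_map x N"
    unfolding gauss_map_def
  proof (intro conjI ballI)
    show "continuous_on (sphere 0 1) N"
      using has_derivative_continuous[OF N'[OF nz]] by (intro continuous_at_imp_continuous_on) auto
    fix p :: "real^'n" assume p: "p \<in> sphere 0 1"
    show "norm (N p) = 1" unfolding N_def by (rule norm_normal[OF Gx[OF nz[OF p]]])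
    show "N p \<bullet> frechet_derivative x (at p) v = 0" for v
      unfolding N_def fx[OF nz[OF p]] inner_commute[of "normal (x p)"] by (rule tan[OF nz[OF p]])
  qed
  have imm: "inj_on (frechet_derivative x (at p)) (tang p)" if p: "p \<in> sphere 0 1" for p
    unfolding fx[OF nz[OF p]] linear_inj_on_iff_eq_0[OF lin(1)[OF nz[OF p]] subspace_tang]
    using inj p by auto
  show ?thesis
  proof (rule exI[of _ x], rule exI[of _ N], rule exI[of _ N'], rule exI[of _ "- {0}"],
      rule exI[of _ "1 / sqrt 2"], intro conjI ballI)
    show "{p \<in> sphere 0 1. GK_curv x N N' p = 0} = band_set e (1 / sqrt 2) F"
      using det(2) by (auto simp: band_set_def)
  qed (use smooth gauss imm rank_ex rank_ge det(1) N'[OF nz] nz in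
      \<open>auto intro: has_derivative_at_withinI\<close>)
qed

section \<open>Good Cantor sets and the choice of constants\<close>

text \<open>By monotonicity of the cosine on [0, pi], a round ball is the trace of an open half
  space.\<close>

lemma geo_ball_equator_iff:
  assumes "c \<in> equator e" "q \<in> equator e" "0 < r" "r \<le> pi"
  shows "q \<in> geo_ball (equator e) c r \<longleftrightarrow> cos r < c \<bullet> q"
proof -
  have "\<bar>c \<bullet> q\<bar> \<le> 1"
    using Cauchy_Schwarz_ineq2[of c q] assms(1,2) by (simp add: equator_def)
  then have "arccos (c \<bullet> q) < r \<longleftrightarrow> cos r < c \<bullet> q"
    using cos_mono_less_eq[of r "arccos (c \<bullet> q)"] assms(3,4) arccos_lbound[of "c \<bullet> q"] arccos_ubound[of "c \<bullet> q"]
    by (simp add: abs_le_iff)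
  then show ?thesis using assms(2) by (simp add: geo_ball_def)
qed

lemma compact_equator: "compact (equator e)"
proof -
  have "equator e = sphere 0 1 \<inter> {q. e \<bullet> q = 0}"
    by (auto simp: equator_def inner_commute)
  then show ?thesis by (simp add: compact_Int_closed closed_hyperplane)
qed

lemma good_cantor_setE:
  fixes e :: "real^'n"
  assumes "good_cantor_set \<delta> e F"
  obtains c :: "nat \<Rightarrow> real^'n" and r where "\<And>i. c i \<in> equator e" "\<And>i. 0 < r i" "\<And>i. r i \<le> \<delta>"
    "\<And>i j. i \<noteq> j \<Longrightarrow> geo_ball (equator e) (c i) (r i) \<inter> geo_ball (equator e) (c j) (r j) = {}"
    "equator e - F = (\<Union>i. geo_ball (equator e) (c i) (r i))" "F \<subseteq> equator e"
proof -
  from assms obtain c :: "nat \<Rightarrow> real^'n" and r where *: "\<forall>i. c i \<in> equator e \<and> 0 < r i \<and> r i \<le> \<delta>"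
    "\<forall>i j. i \<noteq> j \<longrightarrow> geo_ball (equator e) (c i) (r i) \<inter> geo_ball (equator e) (c j) (r j) = {}"
    "equator e - F = (\<Union>i. geo_ball (equator e) (c i) (r i))" "F \<subseteq> equator e"
    unfolding good_cantor_set_def by (elim conjE exE) (rule that; assumption)
  show ?thesis
    by (rule that[OF _ _ _ _ *(3,4)]) (simp_all add: *(1,2))
qed

text \<open>If F were empty, finitely many of the balls would cover the equator by compactness.
  Infinitely many balls exist and each contains its centre, so one outside the finite cover would
  meet one inside it, against disjointness.\<close>

lemma good_cantor_set_nonempty:
  fixes e :: "real^'n"
  assumes "good_cantor_set \<delta> e F" "\<delta> \<le> pi"
  shows "F \<noteq> {}"
proof
  assume "F = {}"
  obtain c :: "nat \<Rightarrow> real^'n" and r where cr: "\<And>i. c i \<in> equator e" "\<And>i. 0 < r i" "\<And>i. r i \<le> \<delta>"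
    and disj: "\<And>i j. i \<noteq> j \<Longrightarrow> geo_ball (equator e) (c i) (r i) \<inter> geo_ball (equator e) (c j) (r j) = {}"
    and cover: "equator e - F = (\<Union>i. geo_ball (equator e) (c i) (r i))" and "F \<subseteq> equator e"
    by (rule good_cantor_setE[OF assms(1)]) blast
  have ball: "q \<in> geo_ball (equator e) (c i) (r i) \<longleftrightarrow> cos (r i) < c i \<bullet> q" if "q \<in> equator e" for q i
    using geo_ball_equator_iff[OF _ that] cr[of i] assms(2) by auto
  have "equator e \<subseteq> (\<Union>i\<in>UNIV. {q. cos (r i) < c i \<bullet> q})"
    using cover \<open>F = {}\<close> ball by blast
  then obtain I where I: "finite I" "equator e \<subseteq> (\<Union>i\<in>I. {q. cos (r i) < c i \<bullet> q})"
    by (rule compactE_image[OF compact_equator open_halfspace_gt]) blast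
  obtain j where j: "j \<notin> I" using I(1) ex_new_if_finite infinite_UNIV_nat by blast
  obtain i where i: "i \<in> I" "c j \<in> geo_ball (equator e) (c i) (r i)"
    using I(2) cr[of j] ball by blast
  have "cos (r j) < 1"
    using cos_mono_less_eq[of "r j" 0] cr[of j] assms(2) by simp
  then have "c j \<in> geo_ball (equator e) (c j) (r j)"
    using ball[of "c j" j] cr[of j] by (auto simp: equator_def dot_square_norm)
  with i disj[of i j] j show False by blast
qed

text \<open>\<open>CARD('n)\<close> is n + 1, so n - 1 reads \<open>CARD('n) - 2\<close>; the
  minimum defining the rank is split into a lower bound everywhere and a point of equality. The
  constant pi / 2 serves every n: it keeps the origin outside the open half spaces of the
  balls.\<close>

theorem theoremA:
  assumes "CARD('n) \<ge> 3"
  shows "\<exists>\<delta>0 > 0. \<forall>(e :: real^'n) F. norm e = 1 \<and> good_cantor_set \<delta>0 e F \<longrightarrow>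
    (\<exists>(x :: real^'n \<Rightarrow> real^'n) N N' U c.
       0 < c \<and> c < 1 \<and> sphere 0 1 \<subseteq> U \<and> smooth_on U x \<and>
       (\<forall>p \<in> sphere 0 1. inj_on (frechet_derivative x (at p)) (tang p)) \<and>
       gauss_map x N \<and>
       (\<forall>p \<in> sphere 0 1. (N has_derivative N' p) (at p within sphere 0 1)) \<and>
       (\<forall>p \<in> sphere 0 1. CARD('n) - 2 \<le> shape_rank N' p) \<and>
       (\<exists>p \<in> sphere 0 1. shape_rank N' p = CARD('n) - 2) \<and>
       (\<forall>p \<in> sphere 0 1. 0 \<le> GK_curv x N N' p) \<and>
       {p \<in> sphere 0 1. GK_curv x N N' p = 0} = band_set e c F)"
proof (intro exI[of _ "pi / 2"] conjI allI impI)
  fix e :: "real^'n" and F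
  assume "norm e = 1 \<and> good_cantor_set (pi / 2) e F"
  then have e: "norm e = 1" and good: "good_cantor_set (pi / 2) e F" by auto
  obtain c :: "nat \<Rightarrow> real^'n" and r where cr: "\<And>i. c i \<in> equator e" "\<And>i. 0 < r i" "\<And>i. r i \<le> pi / 2"
    and "\<And>i j. i \<noteq> j \<Longrightarrow> geo_ball (equator e) (c i) (r i) \<inter> geo_ball (equator e) (c j) (r j) = {}"
    and cover: "equator e - F = (\<Union>i. geo_ball (equator e) (c i) (r i))" and Fe: "F \<subseteq> equator e"
    by (rule good_cantor_setE[OF good]) blast
  obtain B1 where B1: "B1 > 0" "\<And>s. \<bar>flat (flat_deriv [:0, 0, 1:]) s\<bar> \<le> B1"
    using flat_bounded by blast
  obtain B2 where B2: "B2 > 0" "\<And>s. \<bar>flat [:0, 0, 0, 0, 1:] s\<bar> \<le> B2"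
    using flat_bounded by blast
  \<comment> \<open>B1 bounds h'' and B2 bounds h'^2 / h, which is
    \<open>flat [:0, 0, 0, 0, 1:]\<close> for s > 0.\<close>
  define B where "B = max B1 B2"
  have cyl: "bulged_cylinder e c (\<lambda>i. cos (r i)) (1 / (184 * B)) B"
  proof
    show "norm (c i) = 1" "c i \<bullet> e = 0" for i
      using cr[of i] by (auto simp: equator_def)
    \<comment> \<open>Here the radii must be at most pi / 2, not merely at most pi.\<close>
    show "0 \<le> cos (r i)" for i
      using cr[of i] by (intro cos_ge_zero) auto
    show "0 < B" using B1(1) by (simp add: B_def)
    then show "0 < 1 / (184 * B)" "184 * (1 / (184 * B)) * B \<le> 1" by auto
    show "\<bar>flat (flat_deriv [:0, 0, 1:]) s\<bar> \<le> B" for s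
      using B1(2)[of s] by (simp add: B_def)
    show "(flat [:0, 0, 1:] s)\<^sup>2 \<le> B * flat 1 s" for s
    proof -
      have "flat [:0, 0, 0, 0, 1:] s \<le> B" using B2(2)[of s] by (simp add: B_def)
      then show ?thesis unfolding flat_deriv_1_sq by (intro mult_right_mono flat_nonneg) auto
    qed
  qed (rule e)
  have F: "q \<in> F \<longleftrightarrow> (\<forall>i. c i \<bullet> q \<le> cos (r i))" if "norm q = 1" "q \<bullet> e = 0" for q
  proof -
    have q: "q \<in> equator e" using that by (simp add: equator_def)
    have "q \<in> geo_ball (equator e) (c i) (r i) \<longleftrightarrow> cos (r i) < c i \<bullet> q" for i
      using geo_ball_equator_iff[OF _ q, of "c i" "r i"] cr[of i] pi_gt_zero by auto
    then have "q \<in> equator e - F \<longleftrightarrow> (\<exists>i. cos (r i) < c i \<bullet> q)" unfolding cover by auto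
    then show ?thesis using q by (metis DiffE DiffI not_le)
  qed
  show "\<exists>(x :: real^'n \<Rightarrow> real^'n) N N' U c.
       0 < c \<and> c < 1 \<and> sphere 0 1 \<subseteq> U \<and> smooth_on U x \<and>
       (\<forall>p \<in> sphere 0 1. inj_on (frechet_derivative x (at p)) (tang p)) \<and>
       gauss_map x N \<and>
       (\<forall>p \<in> sphere 0 1. (N has_derivative N' p) (at p within sphere 0 1)) \<and>
       (\<forall>p \<in> sphere 0 1. CARD('n) - 2 \<le> shape_rank N' p) \<and>
       (\<exists>p \<in> sphere 0 1. shape_rank N' p = CARD('n) - 2) \<and>
       (\<forall>p \<in> sphere 0 1. 0 \<le> GK_curv x N N' p) \<and>
       {p \<in> sphere 0 1. GK_curv x N N' p = 0} = band_set e c F"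
    using bulged_cylinder_immersion[OF cyl F Fe good_cantor_set_nonempty[OF good]] by simp
qed simp

end
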